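(* For any recursive machine $m$ and any $x,y:\mathbb N$, the types $R_m(x,y)$ and $\sum_{y:\mathbb N}R_m(x,y)$ are Rosolini propositions.
   Context: Type theory: Martin-Löf type theory with universe $\mathcal U$, function extensionality, proposition extensionality and propositional truncations. Recursive machine: a pair $m=(i,s)$ of unary primitive recursive functions, $s$ read as $\mathbb N\to\mathbb N+\mathbb N$ via $\mathrm{inl}(n)=2n$, $\mathrm{inr}(n)=2n+1$; $\operatorname{run}_k(m,x):=s'^k(\mathrm{inl}(i(x)))$ with $s'(\mathrm{inl}\,x)=s(x)$, $s'(\mathrm{inr}\,y)=\mathrm{inr}\,y$. $R_m(x,y):=\big\lVert\sum_{k:\mathbb N}\operatorname{run}_k(m,x)=\mathrm{inr}\,y\big\rVert$. A type $P$ is a Rosolini proposition if there merely exists $\alpha:\mathbb N\to2$ with at most one $1$ such that $P=\sum_n(\alpha_n=1)$. *)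

theory Defs
  imports Main
begin

text \<open>
  The claim is about what can be proved in Martin-Loef type theory, where neither excluded middle
  nor countable choice is available.  Read directly in HOL it would be void, since classically every
  proposition is Rosolini.  Hence the type theory itself is formalized: raw terms, conversion and
  typing, with types \<open>\<Pi>, \<Sigma>, +, \<zero>, \<one>, \<nat>, Id\<close>, a universe, propositional truncation, function
  extensionality and proposition extensionality.

  Terms use de Bruijn indices.  \<open>Type\<close> is not a term of the theory proper: \<open>\<Gamma> \<turnstile> A \<Colon> Type\<close> is the
  judgement that \<open>A\<close> is a type, and nothing derives \<open>\<Gamma> \<turnstile> Type \<Colon> A\<close>.  The universe \<open>Univ\<close> is a
  universe a la Russell.  The first argument of \<open>Split, Case, Abort, UnitRec, NatRec\<close> is the motive
  and binds one variable; the motive of \<open>J\<close> binds two (index 1 the endpoint, index 0 the path).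
\<close>

datatype tm =
    Var nat
  | Type
  | Univ
  | Pi tm tm | Lam tm tm | App tm tm
  | Sig tm tm | Pr tm tm | Split tm tm tm
  | Sum tm tm | InL tm | InR tm | Case tm tm tm tm
  | Empty | Abort tm tm
  | Unit | Star | UnitRec tm tm tm
  | Nat | Ze | Su tm | NatRec tm tm tm tm
  | Eq tm tm tm | Rfl tm | J tm tm tm
  | Trunc tm | TrIn tm | Squash tm tm | TrRec tm tm tm
  | FunExt tm tm tm
  | PropExt tm tm tm tm

definition up_ren :: "(nat \<Rightarrow> nat) \<Rightarrow> nat \<Rightarrow> nat" where
  "up_ren r = case_nat 0 (\<lambda>k. Suc (r k))"

primrec ren :: "(nat \<Rightarrow> nat) \<Rightarrow> tm \<Rightarrow> tm" where
  "ren r (Var i) = Var (r i)"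
| "ren r Type = Type"
| "ren r Univ = Univ"
| "ren r (Pi a b) = Pi (ren r a) (ren (up_ren r) b)"
| "ren r (Lam a b) = Lam (ren r a) (ren (up_ren r) b)"
| "ren r (App a b) = App (ren r a) (ren r b)"
| "ren r (Sig a b) = Sig (ren r a) (ren (up_ren r) b)"
| "ren r (Pr a b) = Pr (ren r a) (ren r b)"
| "ren r (Split a b c) = Split (ren (up_ren r) a) (ren r b) (ren r c)"
| "ren r (Sum a b) = Sum (ren r a) (ren r b)"
| "ren r (InL a) = InL (ren r a)"
| "ren r (InR a) = InR (ren r a)"
| "ren r (Case a b c d) = Case (ren (up_ren r) a) (ren r b) (ren r c) (ren r d)"
| "ren r Empty = Empty"
| "ren r (Abort a b) = Abort (ren (up_ren r) a) (ren r b)"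
| "ren r Unit = Unit"
| "ren r Star = Star"
| "ren r (UnitRec a b c) = UnitRec (ren (up_ren r) a) (ren r b) (ren r c)"
| "ren r Nat = Nat"
| "ren r Ze = Ze"
| "ren r (Su a) = Su (ren r a)"
| "ren r (NatRec a b c d) = NatRec (ren (up_ren r) a) (ren r b) (ren r c) (ren r d)"
| "ren r (Eq a b c) = Eq (ren r a) (ren r b) (ren r c)"
| "ren r (Rfl a) = Rfl (ren r a)"
| "ren r (J a b c) = J (ren (up_ren (up_ren r)) a) (ren r b) (ren r c)"
| "ren r (Trunc a) = Trunc (ren r a)"
| "ren r (TrIn a) = TrIn (ren r a)"
| "ren r (Squash a b) = Squash (ren r a) (ren r b)"
| "ren r (TrRec a b c) = TrRec (ren r a) (ren r b) (ren r c)"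
| "ren r (FunExt a b c) = FunExt (ren r a) (ren r b) (ren r c)"
| "ren r (PropExt a b c d) = PropExt (ren r a) (ren r b) (ren r c) (ren r d)"

abbreviation wk :: "tm \<Rightarrow> tm" where
  "wk \<equiv> ren Suc"

definition up_sub :: "(nat \<Rightarrow> tm) \<Rightarrow> nat \<Rightarrow> tm" where
  "up_sub r = case_nat (Var 0) (\<lambda>k. wk (r k))"

primrec subst :: "(nat \<Rightarrow> tm) \<Rightarrow> tm \<Rightarrow> tm" where
  "subst r (Var i) = r i"
| "subst r Type = Type"
| "subst r Univ = Univ"
| "subst r (Pi a b) = Pi (subst r a) (subst (up_sub r) b)"
| "subst r (Lam a b) = Lam (subst r a) (subst (up_sub r) b)"
| "subst r (App a b) = App (subst r a) (subst r b)"
| "subst r (Sig a b) = Sig (subst r a) (subst (up_sub r) b)"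
| "subst r (Pr a b) = Pr (subst r a) (subst r b)"
| "subst r (Split a b c) = Split (subst (up_sub r) a) (subst r b) (subst r c)"
| "subst r (Sum a b) = Sum (subst r a) (subst r b)"
| "subst r (InL a) = InL (subst r a)"
| "subst r (InR a) = InR (subst r a)"
| "subst r (Case a b c d) = Case (subst (up_sub r) a) (subst r b) (subst r c) (subst r d)"
| "subst r Empty = Empty"
| "subst r (Abort a b) = Abort (subst (up_sub r) a) (subst r b)"
| "subst r Unit = Unit"
| "subst r Star = Star"
| "subst r (UnitRec a b c) = UnitRec (subst (up_sub r) a) (subst r b) (subst r c)"
| "subst r Nat = Nat"
| "subst r Ze = Ze"
| "subst r (Su a) = Su (subst r a)"
| "subst r (NatRec a b c d) = NatRec (subst (up_sub r) a) (subst r b) (subst r c) (subst r d)"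
| "subst r (Eq a b c) = Eq (subst r a) (subst r b) (subst r c)"
| "subst r (Rfl a) = Rfl (subst r a)"
| "subst r (J a b c) = J (subst (up_sub (up_sub r)) a) (subst r b) (subst r c)"
| "subst r (Trunc a) = Trunc (subst r a)"
| "subst r (TrIn a) = TrIn (subst r a)"
| "subst r (Squash a b) = Squash (subst r a) (subst r b)"
| "subst r (TrRec a b c) = TrRec (subst r a) (subst r b) (subst r c)"
| "subst r (FunExt a b c) = FunExt (subst r a) (subst r b) (subst r c)"
| "subst r (PropExt a b c d) = PropExt (subst r a) (subst r b) (subst r c) (subst r d)"

definition inst :: "tm \<Rightarrow> tm \<Rightarrow> tm" where
  "inst B a = subst (case_nat a Var) B"

definition inst2 :: "tm \<Rightarrow> tm \<Rightarrow> tm \<Rightarrow> tm" where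
  "inst2 C b p = subst (case_nat p (case_nat b Var)) C"

text \<open>
  \<open>C\<close> lives in \<open>X # \<Gamma>\<close>; \<open>inst_under n C a\<close> replaces its variable by a term \<open>a\<close> over \<open>\<Gamma>\<close> extended
  by \<open>n\<close> variables.
\<close>

definition inst_under :: "nat \<Rightarrow> tm \<Rightarrow> tm \<Rightarrow> tm" where
  "inst_under n C a = subst (case_nat a (\<lambda>k. Var (k + n))) C"

definition arrow :: "tm \<Rightarrow> tm \<Rightarrow> tm" where
  "arrow A B = Pi A (wk B)"

definition is_prop :: "tm \<Rightarrow> tm" where
  "is_prop A = Pi A (Pi (wk A) (Eq (wk (wk A)) (Var 1) (Var 0)))"

text \<open>
  Definitional equality: the congruence on raw terms generated by the computation rules.  Eta rules
  and a computation rule for truncation are left out; adding them would only enlarge the set of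
  derivable judgements.
\<close>

inductive conv :: "tm \<Rightarrow> tm \<Rightarrow> bool"  (infix "\<approx>" 50) where
  "a \<approx> a"
| "a \<approx> b \<Longrightarrow> b \<approx> a"
| "a \<approx> b \<Longrightarrow> b \<approx> c \<Longrightarrow> a \<approx> c"
| "App (Lam A b) a \<approx> inst b a"
| "Split C f (Pr a b) \<approx> App (App f a) b"
| "Case C f g (InL a) \<approx> App f a"
| "Case C f g (InR b) \<approx> App g b"
| "UnitRec C c Star \<approx> c"
| "NatRec C z s Ze \<approx> z"
| "NatRec C z s (Su n) \<approx> App (App s n) (NatRec C z s n)"
| "J C d (Rfl a) \<approx> d"
| "a \<approx> a' \<Longrightarrow> b \<approx> b' \<Longrightarrow>
    Pi a b \<approx> Pi a' b'"
| "a \<approx> a' \<Longrightarrow> b \<approx> b' \<Longrightarrow>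
    Lam a b \<approx> Lam a' b'"
| "a \<approx> a' \<Longrightarrow> b \<approx> b' \<Longrightarrow>
    App a b \<approx> App a' b'"
| "a \<approx> a' \<Longrightarrow> b \<approx> b' \<Longrightarrow>
    Sig a b \<approx> Sig a' b'"
| "a \<approx> a' \<Longrightarrow> b \<approx> b' \<Longrightarrow>
    Pr a b \<approx> Pr a' b'"
| "a \<approx> a' \<Longrightarrow> b \<approx> b' \<Longrightarrow> c \<approx> c' \<Longrightarrow>
    Split a b c \<approx> Split a' b' c'"
| "a \<approx> a' \<Longrightarrow> b \<approx> b' \<Longrightarrow>
    Sum a b \<approx> Sum a' b'"
| "a \<approx> a' \<Longrightarrow>
    InL a \<approx> InL a'"
| "a \<approx> a' \<Longrightarrow>
    InR a \<approx> InR a'"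
| "a \<approx> a' \<Longrightarrow> b \<approx> b' \<Longrightarrow> c \<approx> c' \<Longrightarrow> d \<approx> d' \<Longrightarrow>
    Case a b c d \<approx> Case a' b' c' d'"
| "a \<approx> a' \<Longrightarrow> b \<approx> b' \<Longrightarrow>
    Abort a b \<approx> Abort a' b'"
| "a \<approx> a' \<Longrightarrow> b \<approx> b' \<Longrightarrow> c \<approx> c' \<Longrightarrow>
    UnitRec a b c \<approx> UnitRec a' b' c'"
| "a \<approx> a' \<Longrightarrow>
    Su a \<approx> Su a'"
| "a \<approx> a' \<Longrightarrow> b \<approx> b' \<Longrightarrow> c \<approx> c' \<Longrightarrow> d \<approx> d' \<Longrightarrow>
    NatRec a b c d \<approx> NatRec a' b' c' d'"
| "a \<approx> a' \<Longrightarrow> b \<approx> b' \<Longrightarrow> c \<approx> c' \<Longrightarrow>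
    Eq a b c \<approx> Eq a' b' c'"
| "a \<approx> a' \<Longrightarrow>
    Rfl a \<approx> Rfl a'"
| "a \<approx> a' \<Longrightarrow> b \<approx> b' \<Longrightarrow> c \<approx> c' \<Longrightarrow>
    J a b c \<approx> J a' b' c'"
| "a \<approx> a' \<Longrightarrow>
    Trunc a \<approx> Trunc a'"
| "a \<approx> a' \<Longrightarrow>
    TrIn a \<approx> TrIn a'"
| "a \<approx> a' \<Longrightarrow> b \<approx> b' \<Longrightarrow>
    Squash a b \<approx> Squash a' b'"
| "a \<approx> a' \<Longrightarrow> b \<approx> b' \<Longrightarrow> c \<approx> c' \<Longrightarrow>
    TrRec a b c \<approx> TrRec a' b' c'"
| "a \<approx> a' \<Longrightarrow> b \<approx> b' \<Longrightarrow> c \<approx> c' \<Longrightarrow>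
    FunExt a b c \<approx> FunExt a' b' c'"
| "a \<approx> a' \<Longrightarrow> b \<approx> b' \<Longrightarrow> c \<approx> c' \<Longrightarrow> d \<approx> d' \<Longrightarrow>
    PropExt a b c d \<approx> PropExt a' b' c' d'"

inductive wf_ctx :: "tm list \<Rightarrow> bool"
  and typing :: "tm list \<Rightarrow> tm \<Rightarrow> tm \<Rightarrow> bool"  ("_ \<turnstile> _ \<Colon> _" [50, 50, 50] 50)
where
  wf_Nil: "wf_ctx []"
| wf_Cons: "\<lbrakk>wf_ctx \<Gamma>; \<Gamma> \<turnstile> A \<Colon> Type\<rbrakk> \<Longrightarrow> wf_ctx (A # \<Gamma>)"
| t_Var: "\<lbrakk>wf_ctx \<Gamma>; i < length \<Gamma>\<rbrakk> \<Longrightarrow> \<Gamma> \<turnstile> Var i \<Colon> ren (\<lambda>k. k + Suc i) (\<Gamma> ! i)"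
| t_conv: "\<lbrakk>\<Gamma> \<turnstile> a \<Colon> A; A \<approx> B; \<Gamma> \<turnstile> B \<Colon> Type\<rbrakk> \<Longrightarrow> \<Gamma> \<turnstile> a \<Colon> B"
| t_Univ: "wf_ctx \<Gamma> \<Longrightarrow> \<Gamma> \<turnstile> Univ \<Colon> Type"
| t_El: "\<Gamma> \<turnstile> A \<Colon> Univ \<Longrightarrow> \<Gamma> \<turnstile> A \<Colon> Type"
| t_Pi: "\<lbrakk>S \<in> {Univ, Type}; \<Gamma> \<turnstile> A \<Colon> S; A # \<Gamma> \<turnstile> B \<Colon> S\<rbrakk> \<Longrightarrow> \<Gamma> \<turnstile> Pi A B \<Colon> S"
| t_Lam: "\<lbrakk>\<Gamma> \<turnstile> Pi A B \<Colon> Type; A # \<Gamma> \<turnstile> b \<Colon> B\<rbrakk> \<Longrightarrow> \<Gamma> \<turnstile> Lam A b \<Colon> Pi A B"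
| t_App: "\<lbrakk>\<Gamma> \<turnstile> f \<Colon> Pi A B; \<Gamma> \<turnstile> a \<Colon> A\<rbrakk> \<Longrightarrow> \<Gamma> \<turnstile> App f a \<Colon> inst B a"
| t_Sig: "\<lbrakk>S \<in> {Univ, Type}; \<Gamma> \<turnstile> A \<Colon> S; A # \<Gamma> \<turnstile> B \<Colon> S\<rbrakk> \<Longrightarrow> \<Gamma> \<turnstile> Sig A B \<Colon> S"
| t_Pr: "\<lbrakk>\<Gamma> \<turnstile> Sig A B \<Colon> Type; \<Gamma> \<turnstile> a \<Colon> A; \<Gamma> \<turnstile> b \<Colon> inst B a\<rbrakk> \<Longrightarrow> \<Gamma> \<turnstile> Pr a b \<Colon> Sig A B"
| t_Split: "\<lbrakk>Sig A B # \<Gamma> \<turnstile> C \<Colon> Type;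
      \<Gamma> \<turnstile> f \<Colon> Pi A (Pi B (inst_under 2 C (Pr (Var 1) (Var 0)))); \<Gamma> \<turnstile> p \<Colon> Sig A B\<rbrakk> \<Longrightarrow>
    \<Gamma> \<turnstile> Split C f p \<Colon> inst C p"
| t_Sum: "\<lbrakk>S \<in> {Univ, Type}; \<Gamma> \<turnstile> A \<Colon> S; \<Gamma> \<turnstile> B \<Colon> S\<rbrakk> \<Longrightarrow> \<Gamma> \<turnstile> Sum A B \<Colon> S"
| t_InL: "\<lbrakk>\<Gamma> \<turnstile> Sum A B \<Colon> Type; \<Gamma> \<turnstile> a \<Colon> A\<rbrakk> \<Longrightarrow> \<Gamma> \<turnstile> InL a \<Colon> Sum A B"
| t_InR: "\<lbrakk>\<Gamma> \<turnstile> Sum A B \<Colon> Type; \<Gamma> \<turnstile> b \<Colon> B\<rbrakk> \<Longrightarrow> \<Gamma> \<turnstile> InR b \<Colon> Sum A B"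
| t_Case: "\<lbrakk>Sum A B # \<Gamma> \<turnstile> C \<Colon> Type; \<Gamma> \<turnstile> f \<Colon> Pi A (inst_under 1 C (InL (Var 0)));
      \<Gamma> \<turnstile> g \<Colon> Pi B (inst_under 1 C (InR (Var 0))); \<Gamma> \<turnstile> t \<Colon> Sum A B\<rbrakk> \<Longrightarrow>
    \<Gamma> \<turnstile> Case C f g t \<Colon> inst C t"
| t_Empty: "wf_ctx \<Gamma> \<Longrightarrow> \<Gamma> \<turnstile> Empty \<Colon> Univ"
| t_Abort: "\<lbrakk>Empty # \<Gamma> \<turnstile> C \<Colon> Type; \<Gamma> \<turnstile> t \<Colon> Empty\<rbrakk> \<Longrightarrow> \<Gamma> \<turnstile> Abort C t \<Colon> inst C t"
| t_Unit: "wf_ctx \<Gamma> \<Longrightarrow> \<Gamma> \<turnstile> Unit \<Colon> Univ"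
| t_Star: "wf_ctx \<Gamma> \<Longrightarrow> \<Gamma> \<turnstile> Star \<Colon> Unit"
| t_UnitRec: "\<lbrakk>Unit # \<Gamma> \<turnstile> C \<Colon> Type; \<Gamma> \<turnstile> c \<Colon> inst C Star; \<Gamma> \<turnstile> t \<Colon> Unit\<rbrakk> \<Longrightarrow>
    \<Gamma> \<turnstile> UnitRec C c t \<Colon> inst C t"
| t_Nat: "wf_ctx \<Gamma> \<Longrightarrow> \<Gamma> \<turnstile> Nat \<Colon> Univ"
| t_Ze: "wf_ctx \<Gamma> \<Longrightarrow> \<Gamma> \<turnstile> Ze \<Colon> Nat"
| t_Su: "\<Gamma> \<turnstile> n \<Colon> Nat \<Longrightarrow> \<Gamma> \<turnstile> Su n \<Colon> Nat"
| t_NatRec: "\<lbrakk>Nat # \<Gamma> \<turnstile> C \<Colon> Type; \<Gamma> \<turnstile> z \<Colon> inst C Ze;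
      \<Gamma> \<turnstile> s \<Colon> Pi Nat (Pi C (inst_under 2 C (Su (Var 1)))); \<Gamma> \<turnstile> n \<Colon> Nat\<rbrakk> \<Longrightarrow>
    \<Gamma> \<turnstile> NatRec C z s n \<Colon> inst C n"
| t_Eq: "\<lbrakk>S \<in> {Univ, Type}; \<Gamma> \<turnstile> A \<Colon> S; \<Gamma> \<turnstile> a \<Colon> A; \<Gamma> \<turnstile> b \<Colon> A\<rbrakk> \<Longrightarrow> \<Gamma> \<turnstile> Eq A a b \<Colon> S"
| t_Rfl: "\<lbrakk>\<Gamma> \<turnstile> A \<Colon> Type; \<Gamma> \<turnstile> a \<Colon> A\<rbrakk> \<Longrightarrow> \<Gamma> \<turnstile> Rfl a \<Colon> Eq A a a"
| t_J: "\<lbrakk>Eq (wk A) (wk a) (Var 0) # A # \<Gamma> \<turnstile> C \<Colon> Type; \<Gamma> \<turnstile> d \<Colon> inst2 C a (Rfl a);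
      \<Gamma> \<turnstile> p \<Colon> Eq A a b\<rbrakk> \<Longrightarrow>
    \<Gamma> \<turnstile> J C d p \<Colon> inst2 C b p"
| t_Trunc: "\<lbrakk>S \<in> {Univ, Type}; \<Gamma> \<turnstile> A \<Colon> S\<rbrakk> \<Longrightarrow> \<Gamma> \<turnstile> Trunc A \<Colon> S"
| t_TrIn: "\<lbrakk>\<Gamma> \<turnstile> A \<Colon> Type; \<Gamma> \<turnstile> a \<Colon> A\<rbrakk> \<Longrightarrow> \<Gamma> \<turnstile> TrIn a \<Colon> Trunc A"
| t_Squash: "\<lbrakk>\<Gamma> \<turnstile> a \<Colon> Trunc A; \<Gamma> \<turnstile> b \<Colon> Trunc A\<rbrakk> \<Longrightarrow> \<Gamma> \<turnstile> Squash a b \<Colon> Eq (Trunc A) a b"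
| t_TrRec: "\<lbrakk>\<Gamma> \<turnstile> B \<Colon> Type; \<Gamma> \<turnstile> h \<Colon> is_prop B; \<Gamma> \<turnstile> f \<Colon> arrow A B; \<Gamma> \<turnstile> t \<Colon> Trunc A\<rbrakk> \<Longrightarrow>
    \<Gamma> \<turnstile> TrRec h f t \<Colon> B"
| t_FunExt: "\<lbrakk>\<Gamma> \<turnstile> f \<Colon> Pi A B; \<Gamma> \<turnstile> g \<Colon> Pi A B;
      \<Gamma> \<turnstile> h \<Colon> Pi A (Eq B (App (wk f) (Var 0)) (App (wk g) (Var 0)))\<rbrakk> \<Longrightarrow>
    \<Gamma> \<turnstile> FunExt f g h \<Colon> Eq (Pi A B) f g"
| t_PropExt: "\<lbrakk>\<Gamma> \<turnstile> P \<Colon> Univ; \<Gamma> \<turnstile> Q \<Colon> Univ; \<Gamma> \<turnstile> h \<Colon> is_prop P; \<Gamma> \<turnstile> k \<Colon> is_prop Q;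
      \<Gamma> \<turnstile> f \<Colon> arrow P Q; \<Gamma> \<turnstile> g \<Colon> arrow Q P\<rbrakk> \<Longrightarrow>
    \<Gamma> \<turnstile> PropExt h k f g \<Colon> Eq Univ P Q"

text \<open>
  To write object-level expressions without index arithmetic, an expression is represented as a
  function giving, for every context length \<open>d\<close>, its de Bruijn term in a context of that length.
  Binders are then HOL functions; the variable bound at depth \<open>d\<close> is \<open>Var (d' - Suc d)\<close> when used at
  depth \<open>d'\<close>.  A closed expression \<open>e\<close> denotes the closed term \<open>e 0\<close>.
\<close>

type_synonym expr = "nat \<Rightarrow> tm"

definition bind :: "(expr \<Rightarrow> expr) \<Rightarrow> expr" where
  "bind b = (\<lambda>d. b (\<lambda>d'. Var (d' - Suc d)) (Suc d))"

definition tUniv :: expr where "tUniv = (\<lambda>d. Univ)"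
definition tUnit :: expr where "tUnit = (\<lambda>d. Unit)"
definition tStar :: expr where "tStar = (\<lambda>d. Star)"
definition tNat :: expr where "tNat = (\<lambda>d. Nat)"
definition tZe :: expr where "tZe = (\<lambda>d. Ze)"
definition tSu :: "expr \<Rightarrow> expr" where "tSu n = (\<lambda>d. Su (n d))"
definition tPi :: "expr \<Rightarrow> (expr \<Rightarrow> expr) \<Rightarrow> expr" where
  "tPi A B = (\<lambda>d. Pi (A d) (bind B d))"
definition tLam :: "expr \<Rightarrow> (expr \<Rightarrow> expr) \<Rightarrow> expr" where
  "tLam A b = (\<lambda>d. Lam (A d) (bind b d))"
definition tApp :: "expr \<Rightarrow> expr \<Rightarrow> expr" where
  "tApp f a = (\<lambda>d. App (f d) (a d))"
definition tSig :: "expr \<Rightarrow> (expr \<Rightarrow> expr) \<Rightarrow> expr" where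
  "tSig A B = (\<lambda>d. Sig (A d) (bind B d))"
definition tPr :: "expr \<Rightarrow> expr \<Rightarrow> expr" where
  "tPr a b = (\<lambda>d. Pr (a d) (b d))"
definition tSum :: "expr \<Rightarrow> expr \<Rightarrow> expr" where
  "tSum A B = (\<lambda>d. Sum (A d) (B d))"
definition tInL :: "expr \<Rightarrow> expr" where "tInL a = (\<lambda>d. InL (a d))"
definition tInR :: "expr \<Rightarrow> expr" where "tInR b = (\<lambda>d. InR (b d))"
definition tEq :: "expr \<Rightarrow> expr \<Rightarrow> expr \<Rightarrow> expr" where
  "tEq A a b = (\<lambda>d. Eq (A d) (a d) (b d))"
definition tTrunc :: "expr \<Rightarrow> expr" where "tTrunc A = (\<lambda>d. Trunc (A d))"
definition tIsProp :: "expr \<Rightarrow> expr" where "tIsProp A = (\<lambda>d. is_prop (A d))"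

definition tArr :: "expr \<Rightarrow> expr \<Rightarrow> expr" where
  "tArr A B = tPi A (\<lambda>_. B)"
definition tProd :: "expr \<Rightarrow> expr \<Rightarrow> expr" where
  "tProd A B = tSig A (\<lambda>_. B)"

definition tSplit ::
    "expr \<Rightarrow> (expr \<Rightarrow> expr) \<Rightarrow> (expr \<Rightarrow> expr) \<Rightarrow> (expr \<Rightarrow> expr \<Rightarrow> expr) \<Rightarrow> expr \<Rightarrow> expr" where
  "tSplit A B C f p = (\<lambda>d. Split (bind C d) (tLam A (\<lambda>x. tLam (B x) (\<lambda>y. f x y)) d) (p d))"
definition tCase ::
    "expr \<Rightarrow> expr \<Rightarrow> (expr \<Rightarrow> expr) \<Rightarrow> (expr \<Rightarrow> expr) \<Rightarrow> (expr \<Rightarrow> expr) \<Rightarrow> expr \<Rightarrow> expr" where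
  "tCase A B C f g t = (\<lambda>d. Case (bind C d) (tLam A f d) (tLam B g d) (t d))"
definition tNatRec :: "(expr \<Rightarrow> expr) \<Rightarrow> expr \<Rightarrow> (expr \<Rightarrow> expr \<Rightarrow> expr) \<Rightarrow> expr \<Rightarrow> expr" where
  "tNatRec C z s n =
     (\<lambda>d. NatRec (bind C d) (z d) (tLam tNat (\<lambda>k. tLam (C k) (\<lambda>r. s k r)) d) (n d))"

definition tFst :: "expr \<Rightarrow> (expr \<Rightarrow> expr) \<Rightarrow> expr \<Rightarrow> expr" where
  "tFst A B p = tSplit A B (\<lambda>_. A) (\<lambda>x y. x) p"
text \<open>The second projection is only needed for non-dependent pairs.\<close>
definition tSnd :: "expr \<Rightarrow> expr \<Rightarrow> expr \<Rightarrow> expr" where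
  "tSnd A B p = tSplit A (\<lambda>_. B) (\<lambda>_. B) (\<lambda>x y. y) p"

definition tTwo :: expr where "tTwo = tSum tUnit tUnit"
definition tOne2 :: expr where "tOne2 = tInR tStar"

subsection \<open>Primitive recursive functions\<close>

text \<open>\<open>tVec n\<close> is \<open>\<nat>\<^sup>n\<close>, computing as \<open>\<nat>\<^sup>0 = \<one>\<close> and \<open>\<nat>\<^bsup>n+1\<^esup> = \<nat> \<times> \<nat>\<^sup>n\<close>.\<close>

definition tVec :: "expr \<Rightarrow> expr" where
  "tVec n = tNatRec (\<lambda>_. tUniv) tUnit (\<lambda>_ X. tProd tNat X) n"

text \<open>Head and tail of a vector of length \<open>n + 1\<close>.\<close>
definition tHd :: "expr \<Rightarrow> expr \<Rightarrow> expr" where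
  "tHd n v = tFst tNat (\<lambda>_. tVec n) v"
definition tTl :: "expr \<Rightarrow> expr \<Rightarrow> expr" where
  "tTl n v = tSnd tNat (tVec n) v"

definition tFunc :: "expr \<Rightarrow> expr" where
  "tFunc n = tArr (tVec n) tNat"

definition tAdd :: "expr \<Rightarrow> expr \<Rightarrow> expr" where
  "tAdd m n = tNatRec (\<lambda>_. tNat) n (\<lambda>_ r. tSu r) m"

text \<open>The projection \<open>\<nat>\<^bsup>i+(n+1)\<^esup> \<rightarrow> \<nat>\<close> onto the component with index \<open>i\<close> (counted from 0).\<close>
definition tProj :: "expr \<Rightarrow> expr \<Rightarrow> expr" where
  "tProj i n = tNatRec (\<lambda>i. tFunc (tAdd i (tSu n)))
     (tLam (tVec (tSu n)) (\<lambda>v. tHd n v))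
     (\<lambda>i r. tLam (tVec (tSu (tAdd i (tSu n)))) (\<lambda>v. tApp r (tTl (tAdd i (tSu n)) v)))
     i"

definition tMem :: "expr \<Rightarrow> expr \<Rightarrow> expr \<Rightarrow> expr" where
  "tMem C n f = tApp (tApp C n) f"

text \<open>All \<open>m\<close> components of \<open>h : \<nat>\<^sup>n \<rightarrow> \<nat>\<^sup>m\<close> belong to the class \<open>C\<close>.\<close>
definition tComponents :: "expr \<Rightarrow> expr \<Rightarrow> expr \<Rightarrow> expr \<Rightarrow> expr" where
  "tComponents C n m h =
     tApp (tNatRec (\<lambda>m. tArr (tArr (tVec n) (tVec m)) tUniv)
       (tLam (tArr (tVec n) (tVec tZe)) (\<lambda>h. tUnit))
       (\<lambda>m r. tLam (tArr (tVec n) (tVec (tSu m))) (\<lambda>h.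
          tProd (tMem C n (tLam (tVec n) (\<lambda>v. tHd m (tApp h v))))
                (tApp r (tLam (tVec n) (\<lambda>v. tTl m (tApp h v))))))
       m) h"

text \<open>
  \<open>f : \<nat> \<rightarrow> \<nat>\<close> is primitive recursive if it belongs, as a function \<open>\<nat>\<^sup>1 \<rightarrow> \<nat>\<close>, to the least
  (proposition-valued) class of functions \<open>\<nat>\<^sup>n \<rightarrow> \<nat>\<close> that contains zero, successor and the
  projections and is closed under composition and primitive recursion.
\<close>

definition tIsPrimRec :: "expr \<Rightarrow> expr" where
  "tIsPrimRec f = tPi (tPi tNat (\<lambda>n. tArr (tFunc n) tUniv)) (\<lambda>C.
     tArr (tPi tNat (\<lambda>n. tPi (tFunc n) (\<lambda>g. tIsProp (tMem C n g)))) (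
     tArr (tMem C tZe (tLam (tVec tZe) (\<lambda>v. tZe))) (
     tArr (tMem C (tSu tZe) (tLam (tVec (tSu tZe)) (\<lambda>v. tSu (tHd tZe v)))) (
     tArr (tPi tNat (\<lambda>i. tPi tNat (\<lambda>n. tMem C (tAdd i (tSu n)) (tProj i n)))) (
     tArr (tPi tNat (\<lambda>m. tPi tNat (\<lambda>n. tPi (tFunc m) (\<lambda>g. tPi (tArr (tVec n) (tVec m)) (\<lambda>h.
             tArr (tMem C m g) (tArr (tComponents C n m h)
               (tMem C n (tLam (tVec n) (\<lambda>v. tApp g (tApp h v)))))))))) (
     tArr (tPi tNat (\<lambda>n. tPi (tFunc n) (\<lambda>g. tPi (tFunc (tSu (tSu n))) (\<lambda>h.
             tArr (tMem C n g) (tArr (tMem C (tSu (tSu n)) h)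
               (tMem C (tSu n) (tLam (tVec (tSu n)) (\<lambda>v.
                  tNatRec (\<lambda>_. tNat) (tApp g (tTl n v))
                    (\<lambda>k r. tApp h (tPr k (tPr r (tTl n v)))) (tHd n v))))))))) (
     tMem C (tSu tZe) (tLam (tVec (tSu tZe)) (\<lambda>v. tApp f (tHd tZe v))))))))))"

definition tPrimRec :: expr where
  "tPrimRec = tSig (tArr tNat tNat) tIsPrimRec"

text \<open>The underlying function \<open>\<nat> \<rightarrow> \<nat>\<close> of an element of \<open>tPrimRec\<close>.\<close>
definition tFun :: "expr \<Rightarrow> expr" where
  "tFun p = tFst (tArr tNat tNat) tIsPrimRec p"

subsection \<open>Recursive machines\<close>

definition tMachine :: expr where
  "tMachine = tProd tPrimRec tPrimRec"
definition tInit :: "expr \<Rightarrow> expr" where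
  "tInit m = tFun (tFst tPrimRec (\<lambda>_. tPrimRec) m)"
definition tStep :: "expr \<Rightarrow> expr" where
  "tStep m = tFun (tSnd tPrimRec tPrimRec m)"

definition tNN :: expr where "tNN = tSum tNat tNat"

text \<open>The inverse of the encoding \<open>inl n \<mapsto> 2n\<close>, \<open>inr n \<mapsto> 2n + 1\<close>, by recursion.\<close>
definition tDecode :: "expr \<Rightarrow> expr" where
  "tDecode n = tNatRec (\<lambda>_. tNN) (tInL tZe)
     (\<lambda>_ r. tCase tNat tNat (\<lambda>_. tNN) (\<lambda>a. tInR a) (\<lambda>b. tInL (tSu b)) r) n"

text \<open>The map \<open>s'\<close> on \<open>\<nat> + \<nat>\<close>.\<close>
definition tStep' :: "expr \<Rightarrow> expr \<Rightarrow> expr" where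
  "tStep' m w = tCase tNat tNat (\<lambda>_. tNN) (\<lambda>a. tDecode (tApp (tStep m) a)) (\<lambda>b. tInR b) w"

definition tRun :: "expr \<Rightarrow> expr \<Rightarrow> expr \<Rightarrow> expr" where
  "tRun k m x = tNatRec (\<lambda>_. tNN) (tInL (tApp (tInit m) x)) (\<lambda>_ w. tStep' m w) k"

definition tR :: "expr \<Rightarrow> expr \<Rightarrow> expr \<Rightarrow> expr" where
  "tR m x y = tTrunc (tSig tNat (\<lambda>k. tEq tNN (tRun k m x) (tInR y)))"

definition tIsRosolini :: "expr \<Rightarrow> expr" where
  "tIsRosolini P = tTrunc (tSig (tArr tNat tTwo) (\<lambda>\<alpha>.
     tProd (tPi tNat (\<lambda>j. tPi tNat (\<lambda>k.
              tArr (tEq tTwo (tApp \<alpha> j) tOne2) (tArr (tEq tTwo (tApp \<alpha> k) tOne2) (tEq tNat j k)))))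
           (tEq tUniv P (tSig tNat (\<lambda>n. tEq tTwo (tApp \<alpha> n) tOne2)))))"

definition provable :: "expr \<Rightarrow> bool" where
  "provable A \<longleftrightarrow> (\<exists>t. [] \<turnstile> t \<Colon> A 0)"

end

theory Submission
  imports Defs
begin

text \<open>
  Let \<open>w : \<nat> \<rightarrow> \<nat> + \<nat>\<close> be the sequence of states of a run: it starts in the left summand, and once it
  is \<open>inr z\<close> it stays \<open>inr z\<close>.  For a decidable \<open>p : \<nat> \<rightarrow> 2\<close> let \<open>\<alpha> n = 1\<close> iff \<open>w n\<close> is in the left
  summand, \<open>w (n + 1) = inr z\<close> and \<open>p z = 1\<close>.  At most one such transition exists, and one exists as soon
  as \<open>w k = inr z\<close> with \<open>p z = 1\<close> for some \<open>k\<close>.  With \<open>p z\<close> the decidable equality \<open>z = y\<close>, proposition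
  extensionality identifies \<open>R\<^sub>m(x,y)\<close> with \<open>\<Sigma> n. \<alpha> n = 1\<close>; with \<open>p\<close> constantly true it does so for
  \<open>\<Sigma> y. R\<^sub>m(x,y)\<close>, which is a proposition because \<open>y\<close> is unique and equality of numbers is decidable.

  The corresponding terms of the object theory are typed by a bidirectional type checker whose
  soundness is proved and which is then run inside the logic.
\<close>

subsection \<open>A sound type checker\<close>

fun whnf :: "nat \<Rightarrow> tm \<Rightarrow> tm" where
  "whnf 0 t = t"
| "whnf (Suc n) t = (case t of
     App f a \<Rightarrow> (case whnf n f of Lam A b \<Rightarrow> whnf n (inst b a) | _ \<Rightarrow> t)
   | Split C f p \<Rightarrow> (case whnf n p of Pr a b \<Rightarrow> whnf n (App (App f a) b) | _ \<Rightarrow> t)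
   | Case C f g s \<Rightarrow> (case whnf n s of InL a \<Rightarrow> whnf n (App f a) | InR b \<Rightarrow> whnf n (App g b) | _ \<Rightarrow> t)
   | UnitRec C c s \<Rightarrow> (case whnf n s of Star \<Rightarrow> whnf n c | _ \<Rightarrow> t)
   | NatRec C z s m \<Rightarrow> (case whnf n m of Ze \<Rightarrow> whnf n z
        | Su k \<Rightarrow> whnf n (App (App s k) (NatRec C z s k)) | _ \<Rightarrow> t)
   | J C d p \<Rightarrow> (case whnf n p of Rfl a \<Rightarrow> whnf n d | _ \<Rightarrow> t)
   | _ \<Rightarrow> t)"

text \<open>A constructor tag with the immediate subterms, so that one congruence step covers all
  constructors. Variables start at 30, above every other tag, and thus distinct variables get
  distinct tags.\<close>

primrec node :: "tm \<Rightarrow> nat \<times> tm list" where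
  "node (Var i) = (30 + i, [])"
| "node Type = (0, [])"
| "node Univ = (1, [])"
| "node (Pi a b) = (2, [a, b])"
| "node (Lam a b) = (3, [a, b])"
| "node (App a b) = (4, [a, b])"
| "node (Sig a b) = (5, [a, b])"
| "node (Pr a b) = (6, [a, b])"
| "node (Split a b c) = (7, [a, b, c])"
| "node (Sum a b) = (8, [a, b])"
| "node (InL a) = (9, [a])"
| "node (InR a) = (10, [a])"
| "node (Case a b c d) = (11, [a, b, c, d])"
| "node Empty = (12, [])"
| "node (Abort a b) = (13, [a, b])"
| "node Unit = (14, [])"
| "node Star = (15, [])"
| "node (UnitRec a b c) = (16, [a, b, c])"
| "node Nat = (17, [])"
| "node Ze = (18, [])"
| "node (Su a) = (19, [a])"
| "node (NatRec a b c d) = (20, [a, b, c, d])"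
| "node (Eq a b c) = (21, [a, b, c])"
| "node (Rfl a) = (22, [a])"
| "node (J a b c) = (23, [a, b, c])"
| "node (Trunc a) = (24, [a])"
| "node (TrIn a) = (25, [a])"
| "node (Squash a b) = (26, [a, b])"
| "node (TrRec a b c) = (27, [a, b, c])"
| "node (FunExt a b c) = (28, [a, b, c])"
| "node (PropExt a b c d) = (29, [a, b, c, d])"

text \<open>Both terms are reduced and then compared node by node. When the fuel runs out only
  identical terms are accepted, so the test may miss conversions but never accepts a wrong
  one.\<close>

fun convertible :: "nat \<Rightarrow> tm \<Rightarrow> tm \<Rightarrow> bool" where
  "convertible 0 a b = (a = b)"
| "convertible (Suc n) a b = (if a = b then True else
     (case node (whnf n a) of (k, as) \<Rightarrow> case node (whnf n b) of (l, bs) \<Rightarrow>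
        if k = l then list_all2 (convertible n) as bs else False))"

text \<open>Equal tags force the same constructor, and for variables the same index; reflexivity or
  the congruence rule of that constructor does the rest.\<close>

lemma conv_node:
  assumes "fst (node a) = fst (node b)" "list_all2 (\<approx>) (snd (node a)) (snd (node b))"
  shows "a \<approx> b"
  using assms by (cases a; cases b) (auto intro: conv.intros(1) conv.intros(12-))

text \<open>Induction on the fuel: congruence replaces the scrutinee by its reduct, one computation
  rule fires, and the induction hypothesis continues from there. A stuck term is returned
  unchanged.\<close>

lemma whnf_conv: "t \<approx> whnf n t"
proof (induction n arbitrary: t)
  case (Suc n)
  show ?case
  proof (cases t)
    case (App f a)
    { fix A b assume "whnf n f = Lam A b"
      then have "f \<approx> Lam A b" using Suc[of f] by simp
      then have "App f a \<approx> inst b a" by (meson conv.intros)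
      then have "App f a \<approx> whnf n (inst b a)" using Suc by (meson conv.intros) }
    then show ?thesis using App by (auto split: tm.split intro: conv.intros(1))
  next
    case (Split C f p)
    { fix a b assume "whnf n p = Pr a b"
      then have "p \<approx> Pr a b" using Suc[of p] by simp
      then have "Split C f p \<approx> App (App f a) b" by (meson conv.intros)
      then have "Split C f p \<approx> whnf n (App (App f a) b)" using Suc by (meson conv.intros) }
    then show ?thesis using Split by (auto split: tm.split intro: conv.intros(1))
  next
    case (Case C f g s)
    { fix a assume "whnf n s = InL a"
      then have "s \<approx> InL a" using Suc[of s] by simp
      then have "Case C f g s \<approx> App f a" by (meson conv.intros)
      then have "Case C f g s \<approx> whnf n (App f a)" using Suc by (meson conv.intros) }
    moreover
    { fix a assume "whnf n s = InR a"
      then have "s \<approx> InR a" using Suc[of s] by simp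
      then have "Case C f g s \<approx> App g a" by (meson conv.intros)
      then have "Case C f g s \<approx> whnf n (App g a)" using Suc by (meson conv.intros) }
    ultimately show ?thesis using Case by (auto split: tm.split intro: conv.intros(1))
  next
    case (UnitRec C c s)
    { assume "whnf n s = Star"
      then have "s \<approx> Star" using Suc[of s] by simp
      then have "UnitRec C c s \<approx> c" by (meson conv.intros)
      then have "UnitRec C c s \<approx> whnf n c" using Suc by (meson conv.intros) }
    then show ?thesis using UnitRec by (auto split: tm.split intro: conv.intros(1))
  next
    case (NatRec C z s m)
    { assume "whnf n m = Ze"
      then have "m \<approx> Ze" using Suc[of m] by simp
      then have "NatRec C z s m \<approx> z" by (meson conv.intros)
      then have "NatRec C z s m \<approx> whnf n z" using Suc by (meson conv.intros) }
    moreover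
    { fix k assume "whnf n m = Su k"
      then have "m \<approx> Su k" using Suc[of m] by simp
      then have "NatRec C z s m \<approx> App (App s k) (NatRec C z s k)" by (meson conv.intros)
      then have "NatRec C z s m \<approx> whnf n (App (App s k) (NatRec C z s k))"
        using Suc by (meson conv.intros) }
    ultimately show ?thesis using NatRec by (auto split: tm.split intro: conv.intros(1))
  next
    case (J C d p)
    { fix a assume "whnf n p = Rfl a"
      then have "p \<approx> Rfl a" using Suc[of p] by simp
      then have "J C d p \<approx> d" by (meson conv.intros)
      then have "J C d p \<approx> whnf n d" using Suc by (meson conv.intros) }
    then show ?thesis using J by (auto split: tm.split intro: conv.intros(1))
  qed (simp_all add: conv.intros(1))
qed (simp add: conv.intros(1))

lemma convertible_conv: "convertible n a b \<Longrightarrow> a \<approx> b"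
proof (induction n arbitrary: a b)
  case (Suc n)
  show ?case
  proof (cases "a = b")
    case False
    then have "whnf n a \<approx> whnf n b"
      using Suc by (intro conv_node)
        (auto split: prod.splits if_splits elim!: list_all2_mono)
    then show ?thesis by (meson whnf_conv conv.intros(2,3))
  qed (simp add: conv.intros(1))
qed (simp add: conv.intros(1))

section \<open>Bidirectional inference and checking of types\<close>

text \<open>The formation rules ask for one common sort, so a component in \<open>Univ\<close> is
  lifted to \<open>Type\<close> when the other one is only a type.\<close>

definition sort_join :: "tm option \<Rightarrow> tm option \<Rightarrow> tm option" where
  "sort_join r s = (case r of None \<Rightarrow> None | Some S \<Rightarrow> (case s of None \<Rightarrow> None
     | Some S' \<Rightarrow> if S = Univ then Some S' else Some Type))"

text \<open>The last argument selects the mode: \<open>None\<close> infers a type,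
  \<open>Some T\<close> checks against \<open>T\<close>. The step functions take the checker for
  subterms as a parameter, so each can be proved sound relative to an arbitrary sound one.\<close>

type_synonym checker = "tm list \<Rightarrow> tm \<Rightarrow> tm option \<Rightarrow> tm option"

definition check :: "checker \<Rightarrow> tm list \<Rightarrow> tm \<Rightarrow> tm \<Rightarrow> bool" where
  "check r \<Gamma> t T = (case r \<Gamma> t (Some T) of None \<Rightarrow> False | Some _ \<Rightarrow> True)"

text \<open>\<open>Type\<close> must be met literally: it has no type itself, so
  \<open>t_conv\<close> cannot lead to it. \<open>Univ\<close> is a type, so reduction to
  \<open>Univ\<close> suffices.\<close>

definition sort_of :: "checker \<Rightarrow> nat \<Rightarrow> tm list \<Rightarrow> tm \<Rightarrow> tm option" where
  "sort_of r n \<Gamma> A = (case r \<Gamma> A None of None \<Rightarrow> None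
     | Some S \<Rightarrow> if S = Type then Some Type else if whnf n S = Univ then Some Univ else None)"

text \<open>Subject reduction is not available, so a reduced type is checked again.\<close>

definition retype :: "checker \<Rightarrow> nat \<Rightarrow> tm list \<Rightarrow> tm \<Rightarrow> tm \<Rightarrow> tm option" where
  "retype r n \<Gamma> T T' = (if T' = T then Some T else if sort_of r n \<Gamma> T' = None then None else Some T')"

definition expose :: "checker \<Rightarrow> nat \<Rightarrow> tm list \<Rightarrow> tm \<Rightarrow> tm option" where
  "expose r n \<Gamma> T = retype r n \<Gamma> T (whnf n T)"

definition check_only :: "tm \<Rightarrow> bool" where
  "check_only t = (case t of Lam _ _ \<Rightarrow> True | Pr _ _ \<Rightarrow> True | InL _ \<Rightarrow> True | InR _ \<Rightarrow> True | Rfl _ \<Rightarrow> True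
     | TrIn _ \<Rightarrow> True | TrRec _ _ _ \<Rightarrow> True | PropExt _ _ _ _ \<Rightarrow> True | _ \<Rightarrow> False)"

text \<open>In contrast to \<open>check\<close>, nothing is presupposed about the expected type: it
  is itself checked, except where it is identical to the inferred type, since then the typing is
  already at hand.\<close>

definition check_formed :: "checker \<Rightarrow> nat \<Rightarrow> tm list \<Rightarrow> tm \<Rightarrow> tm \<Rightarrow> bool" where
  "check_formed r n \<Gamma> t T = (if check_only t
     then if sort_of r n \<Gamma> T = None then False else check r \<Gamma> t T
     else (case r \<Gamma> t None of None \<Rightarrow> False
       | Some T' \<Rightarrow> if T' = T then True else if sort_of r n \<Gamma> T = None then False else convertible n T' T))"

text \<open>The domains of the branches of \<open>Split\<close> and \<open>Case\<close> are read off
  the annotations of their lambdas. Instances of a motive that occur in branch types are checked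
  afresh, which takes the place of a substitution lemma.\<close>

definition infer_step :: "(nat \<Rightarrow> tm option) \<Rightarrow> checker \<Rightarrow> nat \<Rightarrow> tm list \<Rightarrow> tm \<Rightarrow> tm option" where
  "infer_step E r n \<Gamma> t = (case t of
     Var i \<Rightarrow> if i < length \<Gamma> then Some (ren (\<lambda>k. k + Suc i) (\<Gamma> ! i))
       else (case E (i - length \<Gamma>) of None \<Rightarrow> None | Some A \<Rightarrow> Some (ren (\<lambda>k. k + Suc i) A))
   | Univ \<Rightarrow> Some Type
   | Pi A B \<Rightarrow> (case sort_of r n \<Gamma> A of None \<Rightarrow> None | Some S \<Rightarrow> sort_join (Some S) (sort_of r n (A # \<Gamma>) B))
   | Lam A b \<Rightarrow> if sort_of r n \<Gamma> A = None then None else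
       (case r (A # \<Gamma>) b None of None \<Rightarrow> None
        | Some B \<Rightarrow> if sort_of r n (A # \<Gamma>) B = None then None else Some (Pi A B))
   | App f a \<Rightarrow> (case r \<Gamma> f None of None \<Rightarrow> None
        | Some T \<Rightarrow> (case expose r n \<Gamma> T of
            Some (Pi A B) \<Rightarrow> if check_formed r n \<Gamma> a A then Some (inst B a) else None
          | _ \<Rightarrow> None))
   | Sig A B \<Rightarrow> (case sort_of r n \<Gamma> A of None \<Rightarrow> None | Some S \<Rightarrow> sort_join (Some S) (sort_of r n (A # \<Gamma>) B))
   | Split C f p \<Rightarrow> (case f of Lam A f' \<Rightarrow> (case f' of Lam B _ \<Rightarrow>
          if sort_of r n \<Gamma> (Sig A B) = None then None
          else if sort_of r n (Sig A B # \<Gamma>) C = None then None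
          else if sort_of r n (B # A # \<Gamma>) (inst_under 2 C (Pr (Var 1) (Var 0))) = None then None
          else if check r \<Gamma> f (Pi A (Pi B (inst_under 2 C (Pr (Var 1) (Var 0)))))
            then if check r \<Gamma> p (Sig A B) then Some (inst C p) else None
          else None
        | _ \<Rightarrow> None) | _ \<Rightarrow> None)
   | Sum A B \<Rightarrow> sort_join (sort_of r n \<Gamma> A) (sort_of r n \<Gamma> B)
   | Case C f g s \<Rightarrow> (case f of Lam A _ \<Rightarrow> (case g of Lam B _ \<Rightarrow>
          if sort_of r n \<Gamma> (Sum A B) = None then None
          else if sort_of r n (Sum A B # \<Gamma>) C = None then None
          else if sort_of r n (A # \<Gamma>) (inst_under 1 C (InL (Var 0))) = None then None
          else if sort_of r n (B # \<Gamma>) (inst_under 1 C (InR (Var 0))) = None then None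
          else if check r \<Gamma> f (Pi A (inst_under 1 C (InL (Var 0))))
            then if check r \<Gamma> g (Pi B (inst_under 1 C (InR (Var 0))))
            then if check r \<Gamma> s (Sum A B) then Some (inst C s) else None
          else None else None
        | _ \<Rightarrow> None) | _ \<Rightarrow> None)
   | Empty \<Rightarrow> Some Univ
   | Abort C s \<Rightarrow> if sort_of r n (Empty # \<Gamma>) C = None then None
        else if check r \<Gamma> s Empty then Some (inst C s) else None
   | Unit \<Rightarrow> Some Univ
   | Star \<Rightarrow> Some Unit
   | UnitRec C c s \<Rightarrow> if sort_of r n (Unit # \<Gamma>) C = None then None
        else if check_formed r n \<Gamma> c (inst C Star)
          then if check r \<Gamma> s Unit then Some (inst C s) else None
        else None
   | Nat \<Rightarrow> Some Univ
   | Ze \<Rightarrow> Some Nat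
   | Su m \<Rightarrow> if check r \<Gamma> m Nat then Some Nat else None
   | NatRec C z s m \<Rightarrow> if sort_of r n (Nat # \<Gamma>) C = None then None
        else if sort_of r n (C # Nat # \<Gamma>) (inst_under 2 C (Su (Var 1))) = None then None
        else if check_formed r n \<Gamma> z (inst C Ze)
          then if check r \<Gamma> s (Pi Nat (Pi C (inst_under 2 C (Su (Var 1)))))
          then if check r \<Gamma> m Nat then Some (inst C m) else None
        else None else None
   | Eq A a b \<Rightarrow> (case sort_of r n \<Gamma> A of None \<Rightarrow> None
        | Some S \<Rightarrow> if check r \<Gamma> a A then if check r \<Gamma> b A then Some S else None else None)
   | J C d p \<Rightarrow> (case r \<Gamma> p None of None \<Rightarrow> None
        | Some T \<Rightarrow> (case expose r n \<Gamma> T of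
            Some (Eq A a b) \<Rightarrow>
              if sort_of r n \<Gamma> A = None then None
              else if sort_of r n (A # \<Gamma>) (Eq (wk A) (wk a) (Var 0)) = None then None
              else if sort_of r n (Eq (wk A) (wk a) (Var 0) # A # \<Gamma>) C = None then None
              else if check_formed r n \<Gamma> d (inst2 C a (Rfl a)) then Some (inst2 C b p) else None
          | _ \<Rightarrow> None))
   | Trunc A \<Rightarrow> sort_of r n \<Gamma> A
   | Squash a b \<Rightarrow> (case r \<Gamma> a None of None \<Rightarrow> None
        | Some T \<Rightarrow> (case expose r n \<Gamma> T of
            Some (Trunc A) \<Rightarrow> if check_formed r n \<Gamma> b (Trunc A) then Some (Eq (Trunc A) a b) else None
          | _ \<Rightarrow> None))
   | _ \<Rightarrow> None)"

text \<open>Checking presupposes that the expected type is well-formed.\<close>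

definition check_step :: "checker \<Rightarrow> nat \<Rightarrow> tm list \<Rightarrow> tm \<Rightarrow> tm \<Rightarrow> bool" where
  "check_step r n \<Gamma> t T = (case t of
     Lam A b \<Rightarrow> (case expose r n \<Gamma> T of
         Some (Pi A' B) \<Rightarrow> if A = A' then check r (A # \<Gamma>) b B
           else if convertible n A A' then if sort_of r n \<Gamma> A = None then False
           else if sort_of r n (A # \<Gamma>) B = None then False else check r (A # \<Gamma>) b B else False
       | _ \<Rightarrow> False)
   | Pr a b \<Rightarrow> (case expose r n \<Gamma> T of
         Some (Sig A B) \<Rightarrow> if check r \<Gamma> a A then check_formed r n \<Gamma> b (inst B a) else False
       | _ \<Rightarrow> False)
   | InL a \<Rightarrow> (case expose r n \<Gamma> T of Some (Sum A B) \<Rightarrow> check r \<Gamma> a A | _ \<Rightarrow> False)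
   | InR b \<Rightarrow> (case expose r n \<Gamma> T of Some (Sum A B) \<Rightarrow> check r \<Gamma> b B | _ \<Rightarrow> False)
   | Rfl a \<Rightarrow> (case expose r n \<Gamma> T of
         Some (Eq A x y) \<Rightarrow> if check r \<Gamma> a A then if convertible n a x then convertible n a y else False else False
       | _ \<Rightarrow> False)
   | TrIn a \<Rightarrow> (case expose r n \<Gamma> T of Some (Trunc A) \<Rightarrow> check r \<Gamma> a A | _ \<Rightarrow> False)
   | TrRec h f s \<Rightarrow> (case f of Lam A _ \<Rightarrow>
         if check_formed r n \<Gamma> s (Trunc A) then if check_formed r n \<Gamma> f (arrow A T) then check_formed r n \<Gamma> h (is_prop T)
         else False else False
       | _ \<Rightarrow> False)
   | PropExt h k f g \<Rightarrow> (case expose r n \<Gamma> T of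
         Some (Eq U P Q) \<Rightarrow> if U = Univ then
           if check_formed r n \<Gamma> h (is_prop P) then if check_formed r n \<Gamma> k (is_prop Q)
           then if check_formed r n \<Gamma> f (arrow P Q) then check_formed r n \<Gamma> g (arrow Q P)
           else False else False else False else False
       | _ \<Rightarrow> False)
   | _ \<Rightarrow> (case r \<Gamma> t None of None \<Rightarrow> False | Some T' \<Rightarrow> convertible n T' T))"

text \<open>
  \<open>K\<close> recognizes closed types already known to be well-formed, and \<open>E\<close> gives the types of the variables
  beyond the list \<open>\<Gamma>\<close>.  Both are functions rather than lists because evaluation by rewriting slows
  down with the size of the terms that it carries along.
\<close>

primrec typecheck :: "(tm \<Rightarrow> bool) \<Rightarrow> (nat \<Rightarrow> tm option) \<Rightarrow> nat \<Rightarrow> checker" where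
  "typecheck K E 0 \<Gamma> t m = None"
| "typecheck K E (Suc n) \<Gamma> t m = (case m of
       None \<Rightarrow> if K t then Some Type else infer_step E (typecheck K E n) n \<Gamma> t
     | Some T \<Rightarrow> if check_step (typecheck K E n) n \<Gamma> t T then Some T else None)"

section \<open>Soundness of the checker\<close>

fun parts_typed :: "tm list \<Rightarrow> tm \<Rightarrow> bool" where
  "parts_typed \<Gamma> (Pi A B) = (\<Gamma> \<turnstile> A \<Colon> Type \<and> A # \<Gamma> \<turnstile> B \<Colon> Type)"
| "parts_typed \<Gamma> (Sig A B) = (\<Gamma> \<turnstile> A \<Colon> Type \<and> A # \<Gamma> \<turnstile> B \<Colon> Type)"
| "parts_typed \<Gamma> (Sum A B) = (\<Gamma> \<turnstile> A \<Colon> Type \<and> \<Gamma> \<turnstile> B \<Colon> Type)"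
| "parts_typed \<Gamma> (Eq A a b) = (\<Gamma> \<turnstile> A \<Colon> Type \<and> \<Gamma> \<turnstile> a \<Colon> A \<and> \<Gamma> \<turnstile> b \<Colon> A)"
| "parts_typed \<Gamma> (Trunc A) = (\<Gamma> \<turnstile> A \<Colon> Type)"
| "parts_typed \<Gamma> _ = True"

text \<open>Only a formation rule, \<open>t_El\<close> or \<open>t_conv\<close> can have a type
  former as subject, and each passes the typings of the components on. This weak inversion principle
  is all that is needed about derivations.\<close>

lemma typing_parts: "\<Gamma> \<turnstile> t \<Colon> T \<Longrightarrow> parts_typed \<Gamma> t"
  by (induction rule: wf_ctx_typing.inducts(2)[where ?P1.0 = "\<lambda>_. True"]) (auto intro: t_El)

text \<open>Here \<open>\<Delta>\<close> is the ambient context of lemmas, which the checker sees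
  only through its lookup function, while \<open>\<Gamma>\<close> grows under binders.\<close>

definition sound :: "tm list \<Rightarrow> checker \<Rightarrow> bool" where
  "sound \<Delta> r \<longleftrightarrow> (\<forall>\<Gamma> t. wf_ctx (\<Gamma> @ \<Delta>) \<longrightarrow>
     (\<forall>T. r \<Gamma> t None = Some T \<longrightarrow> \<Gamma> @ \<Delta> \<turnstile> t \<Colon> T) \<and>
     (\<forall>T T'. r \<Gamma> t (Some T) = Some T' \<longrightarrow> \<Gamma> @ \<Delta> \<turnstile> T \<Colon> Type \<longrightarrow> \<Gamma> @ \<Delta> \<turnstile> t \<Colon> T))"

context
  fixes r :: checker and n :: nat and \<Delta> :: "tm list"
  assumes r: "sound \<Delta> r"
begin

lemma infer_typed: "r \<Gamma> t None = Some T \<Longrightarrow> wf_ctx (\<Gamma> @ \<Delta>) \<Longrightarrow> \<Gamma> @ \<Delta> \<turnstile> t \<Colon> T"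
  using r unfolding sound_def by blast

lemma check_typed: "check r \<Gamma> t T \<Longrightarrow> wf_ctx (\<Gamma> @ \<Delta>) \<Longrightarrow> \<Gamma> @ \<Delta> \<turnstile> T \<Colon> Type \<Longrightarrow> \<Gamma> @ \<Delta> \<turnstile> t \<Colon> T"
  using r unfolding sound_def check_def by (auto split: option.splits)

lemma sort_of_typed:
  assumes "sort_of r n \<Gamma> A = Some S" and w: "wf_ctx (\<Gamma> @ \<Delta>)"
  shows "S \<in> {Univ, Type}" and "\<Gamma> @ \<Delta> \<turnstile> A \<Colon> S" and "\<Gamma> @ \<Delta> \<turnstile> A \<Colon> Type" and "wf_ctx (A # \<Gamma> @ \<Delta>)"
proof -
  obtain S' where S': "r \<Gamma> A None = Some S'" and
    S: "S' = Type \<and> S = Type \<or> whnf n S' = Univ \<and> S = Univ"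
    using assms(1) by (auto simp: sort_of_def split: option.splits if_splits)
  have *: "\<Gamma> @ \<Delta> \<turnstile> A \<Colon> S'" using infer_typed[OF S' w] .
  show **: "S \<in> {Univ, Type}" using S by auto
  show ***: "\<Gamma> @ \<Delta> \<turnstile> A \<Colon> S"
    using S * t_conv[OF * _ t_Univ[OF w]] whnf_conv[of S' n] by auto
  show "\<Gamma> @ \<Delta> \<turnstile> A \<Colon> Type" using ** *** by (auto intro: t_El)
  then show "wf_ctx (A # \<Gamma> @ \<Delta>)" using w by (auto intro: wf_Cons)
qed

lemma sort_of_not_None:
  assumes "sort_of r n \<Gamma> A \<noteq> None" and w: "wf_ctx (\<Gamma> @ \<Delta>)"
  shows "\<Gamma> @ \<Delta> \<turnstile> A \<Colon> Type" and "wf_ctx (A # \<Gamma> @ \<Delta>)"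
  using assms sort_of_typed by auto

lemma sort_join_typed:
  assumes "sort_of r n \<Gamma> A = Some S1" "sort_of r n \<Gamma>' B = Some S2" "sort_join (Some S1) (Some S2) = Some S"
    "wf_ctx (\<Gamma> @ \<Delta>)" "wf_ctx (\<Gamma>' @ \<Delta>)"
  shows "S \<in> {Univ, Type}" and "\<Gamma> @ \<Delta> \<turnstile> A \<Colon> S" and "\<Gamma>' @ \<Delta> \<turnstile> B \<Colon> S"
  using assms sort_of_typed[of \<Gamma> A S1] sort_of_typed[of \<Gamma>' B S2]
  by (auto simp: sort_join_def split: if_splits)

lemma expose_conv:
  assumes "expose r n \<Gamma> T = Some T'"
  shows "T \<approx> T'" using assms whnf_conv[of T n]
  by (auto simp: expose_def retype_def split: if_splits intro: conv.intros(1))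

lemma expose_typed:
  assumes "expose r n \<Gamma> T = Some T'" "\<Gamma> @ \<Delta> \<turnstile> t \<Colon> T" "wf_ctx (\<Gamma> @ \<Delta>)"
  shows "\<Gamma> @ \<Delta> \<turnstile> t \<Colon> T'"
  using assms expose_conv[OF assms(1)] sort_of_not_None[of \<Gamma> T']
  by (auto simp: expose_def retype_def split: if_splits intro: t_conv)

lemma expose_type:
  assumes "expose r n \<Gamma> T = Some T'" "\<Gamma> @ \<Delta> \<turnstile> T \<Colon> Type" "wf_ctx (\<Gamma> @ \<Delta>)"
  shows "\<Gamma> @ \<Delta> \<turnstile> T' \<Colon> Type" and "parts_typed (\<Gamma> @ \<Delta>) T'" and "\<And>t. \<Gamma> @ \<Delta> \<turnstile> t \<Colon> T' \<Longrightarrow> \<Gamma> @ \<Delta> \<turnstile> t \<Colon> T"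
proof -
  show *: "\<Gamma> @ \<Delta> \<turnstile> T' \<Colon> Type" using assms sort_of_not_None[of \<Gamma> T']
  by (auto simp: expose_def retype_def split: if_splits intro: t_conv)
  then show "parts_typed (\<Gamma> @ \<Delta>) T'" by (rule typing_parts)
  show "\<Gamma> @ \<Delta> \<turnstile> t \<Colon> T" if "\<Gamma> @ \<Delta> \<turnstile> t \<Colon> T'" for t
    using that assms(2) expose_conv[OF assms(1)] by (meson t_conv conv.intros(2))
qed

lemma check_formed_typed:
  assumes "check_formed r n \<Gamma> t T" and w: "wf_ctx (\<Gamma> @ \<Delta>)"
  shows "\<Gamma> @ \<Delta> \<turnstile> t \<Colon> T"
  using assms sort_of_not_None[of \<Gamma> T] check_typed[of \<Gamma> t T] infer_typed[of \<Gamma> t _]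
  by (auto simp: check_formed_def split: if_splits option.splits intro: t_conv convertible_conv)

lemma infer_step_typed:
  assumes "infer_step E r n \<Gamma> t = Some T" and w: "wf_ctx (\<Gamma> @ \<Delta>)"
    and E: "\<And>i A. E i = Some A \<Longrightarrow> i < length \<Delta> \<and> \<Delta> ! i = A"
  shows "\<Gamma> @ \<Delta> \<turnstile> t \<Colon> T"
proof (cases t)
  case (Var i)
  then show ?thesis using assms(1) t_Var[OF w, of i] E[of "i - length \<Gamma>"]
    by (auto simp: infer_step_def nth_append split: if_splits option.splits)
next
  case Univ
  then show ?thesis using assms by (auto simp: infer_step_def intro: t_Univ)
next
  case (Pi A B)
  then obtain S1 S2 where "sort_of r n \<Gamma> A = Some S1" "sort_of r n (A # \<Gamma>) B = Some S2"
    "sort_join (Some S1) (Some S2) = Some T"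
    using assms(1) by (auto simp: infer_step_def sort_join_def split: option.splits)
  from sort_join_typed[OF this w] sort_of_typed(4)[OF this(1) w] show ?thesis
    using Pi by (auto intro: t_Pi)
next
  case (Lam A b)
  then obtain B where B: "sort_of r n \<Gamma> A \<noteq> None" "r (A # \<Gamma>) b None = Some B" "sort_of r n (A # \<Gamma>) B \<noteq> None"
    "T = Pi A B"
    using assms(1) by (auto simp: infer_step_def split: option.splits if_splits)
  have A: "\<Gamma> @ \<Delta> \<turnstile> A \<Colon> Type" and wA: "wf_ctx ((A # \<Gamma>) @ \<Delta>)" using sort_of_not_None[OF B(1) w] by auto
  show ?thesis using infer_typed[OF B(2) wA] sort_of_not_None(1)[OF B(3) wA] A Lam B(4)
    by (auto intro!: t_Lam t_Pi)
next
  case (App f a)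
  then obtain U A B where U: "r \<Gamma> f None = Some U" "expose r n \<Gamma> U = Some (Pi A B)" "check_formed r n \<Gamma> a A"
    "T = inst B a"
    using assms(1) by (auto simp: infer_step_def split: option.splits if_splits tm.splits)
  show ?thesis
    using expose_typed[OF U(2) infer_typed[OF U(1) w] w] check_formed_typed[OF U(3) w] App U(4) by (auto intro: t_App)
next
  case (Sig A B)
  then obtain S1 S2 where "sort_of r n \<Gamma> A = Some S1" "sort_of r n (A # \<Gamma>) B = Some S2"
    "sort_join (Some S1) (Some S2) = Some T"
    using assms(1) by (auto simp: infer_step_def sort_join_def split: option.splits)
  from sort_join_typed[OF this w] sort_of_typed(4)[OF this(1) w] show ?thesis
    using Sig by (auto intro: t_Sig)
next
  case (Split C f p)
  then obtain A B b where f: "f = Lam A (Lam B b)" and s: "sort_of r n \<Gamma> (Sig A B) \<noteq> None"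
    "sort_of r n (Sig A B # \<Gamma>) C \<noteq> None"
    "sort_of r n (B # A # \<Gamma>) (inst_under 2 C (Pr (Var 1) (Var 0))) \<noteq> None"
    "check r \<Gamma> f (Pi A (Pi B (inst_under 2 C (Pr (Var 1) (Var 0)))))"
    "check r \<Gamma> p (Sig A B)" "T = inst C p"
    using assms(1) by (auto simp: infer_step_def split: if_splits tm.splits)
  note t = sort_of_not_None[OF s(1) w]
  \<comment> \<open>Formation of the pair type gives back its components, from which the type of the
    branch is formed.\<close>
  have AB: "\<Gamma> @ \<Delta> \<turnstile> A \<Colon> Type" "A # \<Gamma> @ \<Delta> \<turnstile> B \<Colon> Type" using typing_parts[OF t(1)] by auto
  then have "wf_ctx ((B # A # \<Gamma>) @ \<Delta>)" using w by (auto intro: wf_Cons)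
  from sort_of_not_None(1)[OF s(3) this] AB
  have "\<Gamma> @ \<Delta> \<turnstile> Pi A (Pi B (inst_under 2 C (Pr (Var 1) (Var 0)))) \<Colon> Type" by (auto intro!: t_Pi)
  from t_Split[OF _ check_typed[OF s(4) w this] check_typed[OF s(5) w t(1)]] show ?thesis
    using sort_of_not_None[OF s(2)] t Split s(6) by auto
next
  case (Sum A B)
  then obtain S1 S2 where "sort_of r n \<Gamma> A = Some S1" "sort_of r n \<Gamma> B = Some S2"
    "sort_join (Some S1) (Some S2) = Some T"
    using assms(1) by (auto simp: infer_step_def sort_join_def split: option.splits)
  from sort_join_typed[OF this w w] show ?thesis
    using Sum by (auto intro: t_Sum)
next
  case (Case C f g s)
  then obtain A B b c where f: "f = Lam A b" "g = Lam B c" and s: "sort_of r n \<Gamma> (Sum A B) \<noteq> None"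
    "sort_of r n (Sum A B # \<Gamma>) C \<noteq> None"
    "sort_of r n (A # \<Gamma>) (inst_under 1 C (InL (Var 0))) \<noteq> None"
    "sort_of r n (B # \<Gamma>) (inst_under 1 C (InR (Var 0))) \<noteq> None"
    "check r \<Gamma> f (Pi A (inst_under 1 C (InL (Var 0))))"
    "check r \<Gamma> g (Pi B (inst_under 1 C (InR (Var 0))))"
    "check r \<Gamma> s (Sum A B)" "T = inst C s"
    using assms(1) by (auto simp: infer_step_def split: if_splits tm.splits)
  note t = sort_of_not_None[OF s(1) w]
  have AB: "\<Gamma> @ \<Delta> \<turnstile> A \<Colon> Type" "\<Gamma> @ \<Delta> \<turnstile> B \<Colon> Type" using typing_parts[OF t(1)] by auto
  then have "wf_ctx ((A # \<Gamma>) @ \<Delta>)" "wf_ctx ((B # \<Gamma>) @ \<Delta>)" using w by (auto intro: wf_Cons)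
  from sort_of_not_None(1)[OF s(3) this(1)] sort_of_not_None(1)[OF s(4) this(2)] AB
  have "\<Gamma> @ \<Delta> \<turnstile> Pi A (inst_under 1 C (InL (Var 0))) \<Colon> Type"
    "\<Gamma> @ \<Delta> \<turnstile> Pi B (inst_under 1 C (InR (Var 0))) \<Colon> Type" by (auto intro!: t_Pi)
  from t_Case[OF _ check_typed[OF s(5) w this(1)] check_typed[OF s(6) w this(2)]
      check_typed[OF s(7) w t(1)]] show ?thesis
    using sort_of_not_None[OF s(2)] t Case s(8) by auto
next
  case Empty
  then show ?thesis using assms by (auto simp: infer_step_def intro: t_Empty)
next
  case (Abort C s)
  then have s: "sort_of r n (Empty # \<Gamma>) C \<noteq> None" "check r \<Gamma> s Empty" "T = inst C s"
    using assms(1) by (auto simp: infer_step_def split: if_splits)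
  have t: "\<Gamma> @ \<Delta> \<turnstile> Empty \<Colon> Type" using w by (intro t_El t_Empty)
  show ?thesis using t_Abort[OF _ check_typed[OF s(2) w t]] sort_of_not_None[OF s(1)]
      wf_Cons[OF w t] Abort s(3) by auto
next
  case Unit
  then show ?thesis using assms by (auto simp: infer_step_def intro: t_Unit)
next
  case Star
  then show ?thesis using assms by (auto simp: infer_step_def intro: t_Star)
next
  case (UnitRec C c s)
  then have s: "sort_of r n (Unit # \<Gamma>) C \<noteq> None" "check_formed r n \<Gamma> c (inst C Star)" "check r \<Gamma> s Unit" "T = inst C s"
    using assms(1) by (auto simp: infer_step_def split: if_splits)
  have t: "\<Gamma> @ \<Delta> \<turnstile> Unit \<Colon> Type" using w by (intro t_El t_Unit)
  show ?thesis using t_UnitRec[OF _ check_formed_typed[OF s(2) w] check_typed[OF s(3) w t]]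
      sort_of_not_None[OF s(1)] wf_Cons[OF w t] UnitRec s(4) by auto
next
  case Nat
  then show ?thesis using assms by (auto simp: infer_step_def intro: t_Nat)
next
  case Ze
  then show ?thesis using assms by (auto simp: infer_step_def intro: t_Ze)
next
  case (Su m)
  then show ?thesis using assms check_typed[of \<Gamma> m Nat]
    by (auto simp: infer_step_def intro: t_Su t_El t_Nat split: if_splits)
next
  case (NatRec C z s m)
  then have s: "sort_of r n (Nat # \<Gamma>) C \<noteq> None"
    "sort_of r n (C # Nat # \<Gamma>) (inst_under 2 C (Su (Var 1))) \<noteq> None" "check_formed r n \<Gamma> z (inst C Ze)"
    "check r \<Gamma> s (Pi Nat (Pi C (inst_under 2 C (Su (Var 1)))))" "check r \<Gamma> m Nat" "T = inst C m"
    using assms(1) by (auto simp: infer_step_def split: if_splits)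
  have t: "\<Gamma> @ \<Delta> \<turnstile> Nat \<Colon> Type" using w by (intro t_El t_Nat)
  have "wf_ctx ((Nat # \<Gamma>) @ \<Delta>)" using wf_Cons[OF w t] by simp
  note C = sort_of_not_None[OF s(1) this]
  from C(2) have "wf_ctx ((C # Nat # \<Gamma>) @ \<Delta>)" by simp
  from sort_of_not_None(1)[OF s(2) this] C(1) t
  have "\<Gamma> @ \<Delta> \<turnstile> Pi Nat (Pi C (inst_under 2 C (Su (Var 1)))) \<Colon> Type" by (auto intro!: t_Pi)
  from t_NatRec[OF _ check_formed_typed[OF s(3) w] check_typed[OF s(4) w this] check_typed[OF s(5) w t]] show ?thesis
    using C(1) NatRec s(6) by auto
next
  case (Eq A a b)
  then have s: "sort_of r n \<Gamma> A = Some T" "check r \<Gamma> a A" "check r \<Gamma> b A"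
    using assms(1) by (auto simp: infer_step_def split: if_splits option.splits)
  note t = sort_of_typed[OF s(1) w]
  show ?thesis using t_Eq[OF t(1,2) check_typed[OF s(2) w t(3)] check_typed[OF s(3) w t(3)]] Eq by simp
next
  case (J C d p)
  then obtain U A a b where s: "r \<Gamma> p None = Some U" "expose r n \<Gamma> U = Some (Eq A a b)"
    "sort_of r n \<Gamma> A \<noteq> None" "sort_of r n (A # \<Gamma>) (Eq (wk A) (wk a) (Var 0)) \<noteq> None"
    "sort_of r n (Eq (wk A) (wk a) (Var 0) # A # \<Gamma>) C \<noteq> None"
    "check_formed r n \<Gamma> d (inst2 C a (Rfl a))" "T = inst2 C b p"
    using assms(1) by (auto simp: infer_step_def split: option.splits if_splits tm.splits)
  have "wf_ctx ((A # \<Gamma>) @ \<Delta>)" using sort_of_not_None[OF s(3) w] by simp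
  from sort_of_not_None(2)[OF s(4) this] have "wf_ctx ((Eq (wk A) (wk a) (Var 0) # A # \<Gamma>) @ \<Delta>)" by simp
  from sort_of_not_None(1)[OF s(5) this] show ?thesis
    using t_J[OF _ check_formed_typed[OF s(6) w] expose_typed[OF s(2) infer_typed[OF s(1) w] w]] J s(7) by simp
next
  case (Trunc A)
  then have "sort_of r n \<Gamma> A = Some T" using assms(1) by (simp add: infer_step_def)
  from sort_of_typed[OF this w] show ?thesis using Trunc by (auto intro: t_Trunc)
next
  case (Squash a b)
  then obtain U A where s: "r \<Gamma> a None = Some U" "expose r n \<Gamma> U = Some (Trunc A)"
    "check_formed r n \<Gamma> b (Trunc A)" "T = Eq (Trunc A) a b"
    using assms(1) by (auto simp: infer_step_def split: option.splits if_splits tm.splits)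
  show ?thesis using t_Squash[OF expose_typed[OF s(2) infer_typed[OF s(1) w] w] check_formed_typed[OF s(3) w]]
      Squash s(4) by simp
qed (use assms in \<open>simp_all add: infer_step_def\<close>)

lemma check_step_typed:
  assumes "check_step r n \<Gamma> t T" and w: "wf_ctx (\<Gamma> @ \<Delta>)" and T: "\<Gamma> @ \<Delta> \<turnstile> T \<Colon> Type"
  shows "\<Gamma> @ \<Delta> \<turnstile> t \<Colon> T"
proof -
  have infer: ?thesis if "(case r \<Gamma> t None of None \<Rightarrow> False | Some T' \<Rightarrow> convertible n T' T)"
    using that infer_typed[of \<Gamma> t _] w T by (auto split: option.splits intro: t_conv convertible_conv)
  show ?thesis
  proof (cases t)
    case (Lam A b)
    then obtain A' B where e: "expose r n \<Gamma> T = Some (Pi A' B)" and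
      c: "A = A' \<or> convertible n A A' \<and> sort_of r n \<Gamma> A \<noteq> None \<and> sort_of r n (A # \<Gamma>) B \<noteq> None"
      and b: "check r (A # \<Gamma>) b B"
      using assms(1) by (auto simp: check_step_def split: option.splits if_splits tm.splits)
    note p = expose_type[OF e T w]
    have "A \<approx> A'" using c convertible_conv by (auto intro: conv.intros(1))
    have A: "\<Gamma> @ \<Delta> \<turnstile> A \<Colon> Type" using c p(2) sort_of_not_None[OF _ w] by auto
    have wA: "wf_ctx ((A # \<Gamma>) @ \<Delta>)" using A w by (auto intro: wf_Cons)
    have B: "(A # \<Gamma>) @ \<Delta> \<turnstile> B \<Colon> Type" using c p(2) sort_of_not_None(1)[OF _ wA] by auto
    \<comment> \<open>The abstraction is typed with its own annotation first and then moved along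
      the conversion to the expected domain.\<close>
    have "\<Gamma> @ \<Delta> \<turnstile> t \<Colon> Pi A B"
      using check_typed[OF b wA B] A B Lam by (auto intro!: t_Lam t_Pi)
    moreover have "Pi A B \<approx> Pi A' B" using \<open>A \<approx> A'\<close> by (meson conv.intros)
    ultimately show ?thesis using p(1,3) t_conv by blast
  next
    case (Pr a b)
    then obtain A B where e: "expose r n \<Gamma> T = Some (Sig A B)" and "check r \<Gamma> a A" "check_formed r n \<Gamma> b (inst B a)"
      using assms(1) by (auto simp: check_step_def split: option.splits if_splits tm.splits)
    then show ?thesis using expose_type[OF e T w] check_typed[OF _ w] check_formed_typed[OF _ w] Pr
      by (metis parts_typed.simps(2) t_Pr)
  next
    case (InL a)
    then obtain A B where e: "expose r n \<Gamma> T = Some (Sum A B)" and "check r \<Gamma> a A"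
      using assms(1) by (auto simp: check_step_def split: option.splits if_splits tm.splits)
    then show ?thesis using expose_type[OF e T w] check_typed[OF _ w] InL by (auto intro!: t_InL)
  next
    case (InR a)
    then obtain A B where e: "expose r n \<Gamma> T = Some (Sum A B)" and "check r \<Gamma> a B"
      using assms(1) by (auto simp: check_step_def split: option.splits if_splits tm.splits)
    then show ?thesis using expose_type[OF e T w] check_typed[OF _ w] InR by (auto intro!: t_InR)
  next
    case (Rfl a)
    then obtain A x y where e: "expose r n \<Gamma> T = Some (Eq A x y)" and a: "check r \<Gamma> a A"
      and c: "convertible n a x" "convertible n a y"
      using assms(1) by (auto simp: check_step_def split: option.splits if_splits tm.splits)
    note p = expose_type[OF e T w]
    \<comment> \<open>\<open>Rfl a\<close> is typed on the diagonal and then converted at both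
      endpoints.\<close>
    have "\<Gamma> @ \<Delta> \<turnstile> t \<Colon> Eq A a a" using p(2) check_typed[OF a w] Rfl by (auto intro: t_Rfl)
    moreover have "Eq A a a \<approx> Eq A x y" using c by (meson convertible_conv conv.intros)
    ultimately show ?thesis using p(1,3) t_conv by blast
  next
    case (TrIn a)
    then obtain A where e: "expose r n \<Gamma> T = Some (Trunc A)" and "check r \<Gamma> a A"
      using assms(1) by (auto simp: check_step_def split: option.splits if_splits tm.splits)
    then show ?thesis using expose_type[OF e T w] check_typed[OF _ w] TrIn by (auto intro!: t_TrIn)
  next
    case (TrRec h f s)
    then obtain A where "check_formed r n \<Gamma> s (Trunc A)" "check_formed r n \<Gamma> f (arrow A T)" "check_formed r n \<Gamma> h (is_prop T)"
      using assms(1) by (auto simp: check_step_def split: option.splits if_splits tm.splits)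
    then show ?thesis using t_TrRec[OF T] check_formed_typed[OF _ w] TrRec by blast
  next
    case (PropExt h k f g)
    then obtain P Q where e: "expose r n \<Gamma> T = Some (Eq Univ P Q)" and
      "check_formed r n \<Gamma> h (is_prop P)" "check_formed r n \<Gamma> k (is_prop Q)" "check_formed r n \<Gamma> f (arrow P Q)" "check_formed r n \<Gamma> g (arrow Q P)"
      using assms(1) by (auto simp: check_step_def split: option.splits if_splits tm.splits)
    then show ?thesis using expose_type[OF e T w] check_formed_typed[OF _ w] PropExt by (auto intro!: t_PropExt)
  qed (use assms(1) infer in \<open>simp_all add: check_step_def\<close>)
qed

end

lemma sound_typecheck:
  assumes "\<And>A \<Gamma>. K A \<Longrightarrow> wf_ctx \<Gamma> \<Longrightarrow> \<Gamma> \<turnstile> A \<Colon> Type"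
    and "\<And>i A. E i = Some A \<Longrightarrow> i < length \<Delta> \<and> \<Delta> ! i = A"
  shows "sound \<Delta> (typecheck K E n)"
proof (induction n)
  case (Suc n)
  show ?case unfolding sound_def[of \<Delta> "typecheck K E (Suc n)"]
    using infer_step_typed[OF Suc _ _ assms(2)] check_step_typed[OF Suc] assms(1)
    by (auto split: if_splits)
qed (simp add: sound_def)

subsection \<open>Lemmas of the object theory as context entries\<close>

notation tApp (infixl "\<cdot>" 90)

definition tEmpty :: expr where "tEmpty = (\<lambda>d. Empty)"
definition tAbort :: "expr \<Rightarrow> expr \<Rightarrow> expr" where
  "tAbort C t = (\<lambda>d. Abort (bind (\<lambda>_. C) d) (t d))"
definition tUnitRec :: "(expr \<Rightarrow> expr) \<Rightarrow> expr \<Rightarrow> expr \<Rightarrow> expr" where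
  "tUnitRec C c t = (\<lambda>d. UnitRec (bind C d) (c d) (t d))"
definition tRfl :: "expr \<Rightarrow> expr" where "tRfl a = (\<lambda>d. Rfl (a d))"
definition tJ :: "(expr \<Rightarrow> expr \<Rightarrow> expr) \<Rightarrow> expr \<Rightarrow> expr \<Rightarrow> expr" where
  "tJ C e p = (\<lambda>d. J (bind (\<lambda>y. bind (C y)) d) (e d) (p d))"
definition tTrIn :: "expr \<Rightarrow> expr" where "tTrIn a = (\<lambda>d. TrIn (a d))"
definition tSquash :: "expr \<Rightarrow> expr \<Rightarrow> expr" where "tSquash a b = (\<lambda>d. Squash (a d) (b d))"
definition tTrRec :: "expr \<Rightarrow> expr \<Rightarrow> (expr \<Rightarrow> expr) \<Rightarrow> expr \<Rightarrow> expr" where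
  "tTrRec h A f t = (\<lambda>d. TrRec (h d) (tLam A f d) (t d))"
definition tPropExt :: "expr \<Rightarrow> expr \<Rightarrow> expr \<Rightarrow> expr \<Rightarrow> expr" where
  "tPropExt h k f g = (\<lambda>d. PropExt (h d) (k d) (f d) (g d))"

definition tTransport :: "(expr \<Rightarrow> expr) \<Rightarrow> expr \<Rightarrow> expr \<Rightarrow> expr" where
  "tTransport P e p = tJ (\<lambda>y _. P y) e p"
definition tSym :: "expr \<Rightarrow> expr \<Rightarrow> expr \<Rightarrow> expr" where
  "tSym A a p = tTransport (\<lambda>y. tEq A y a) (tRfl a) p"
text \<open>Disjointness of the summands: the family that is \<open>Unit\<close> on the left and
  \<open>Empty\<close> on the right carries \<open>Star\<close> along an equation
  \<open>inl a = inr b\<close> to an element of \<open>Empty\<close>.\<close>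

definition tClash :: "expr \<Rightarrow> expr \<Rightarrow> expr \<Rightarrow> expr" where
  "tClash A B p = tTransport
     (\<lambda>w. tCase A B (\<lambda>_. tUniv) (\<lambda>_. tUnit) (\<lambda>_. tEmpty) w) tStar p"

text \<open>
  A lemma of the object theory is used through a context entry: \<open>hyp j\<close> is the variable for the
  \<open>j\<close>-th entry, counted from the outermost one.
\<close>

definition hyp :: "nat \<Rightarrow> expr" where "hyp j = (\<lambda>d. Var (d - Suc j))"

section \<open>Lemmas entering the context and being discharged again\<close>

definition well_formed :: "(tm \<Rightarrow> bool) \<Rightarrow> (nat \<Rightarrow> tm option) \<Rightarrow> tm \<Rightarrow> bool" where
  "well_formed K E A \<longleftrightarrow> sort_of (typecheck K E 50) 50 [] A \<noteq> None"
definition well_typed :: "(tm \<Rightarrow> bool) \<Rightarrow> (nat \<Rightarrow> tm option) \<Rightarrow> tm \<Rightarrow> tm \<Rightarrow> bool" where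
  "well_typed K E t A \<longleftrightarrow> check (typecheck K E 50) [] t A"

lemma well_formed_typing:
  assumes "well_formed K E A" "wf_ctx \<Delta>"
    and "\<And>A \<Gamma>. K A \<Longrightarrow> wf_ctx \<Gamma> \<Longrightarrow> \<Gamma> \<turnstile> A \<Colon> Type"
    and "\<And>i A. E i = Some A \<Longrightarrow> i < length \<Delta> \<and> \<Delta> ! i = A"
  shows "\<Delta> \<turnstile> A \<Colon> Type"
  using sort_of_not_None(1)[OF sound_typecheck[of K E \<Delta>], of _ _ "[]" A] assms
  by (simp add: well_formed_def)

lemma well_typed_typing:
  assumes "well_typed K E t A" "wf_ctx \<Delta>" "\<Delta> \<turnstile> A \<Colon> Type"
    and "\<And>A \<Gamma>. K A \<Longrightarrow> wf_ctx \<Gamma> \<Longrightarrow> \<Gamma> \<turnstile> A \<Colon> Type"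
    and "\<And>i A. E i = Some A \<Longrightarrow> i < length \<Delta> \<and> \<Delta> ! i = A"
  shows "\<Delta> \<turnstile> t \<Colon> A"
  using check_typed[OF sound_typecheck[of K E \<Delta>], of _ "[]" t A] assms
  by (simp add: well_typed_def)

definition entry :: "tm list \<Rightarrow> nat \<Rightarrow> tm option" where
  "entry \<Delta> i = (if i < length \<Delta> then Some (\<Delta> ! i) else None)"

lemma entry_Some: "entry \<Delta> i = Some A \<Longrightarrow> i < length \<Delta> \<and> \<Delta> ! i = A"
  by (simp add: entry_def split: if_splits)

text \<open>The entries of such a context are harmless, since a closed type inhabited over it is
  inhabited outright. Asking for formation in every context and stability under every substitution
  avoids weakening and substitution lemmas.\<close>

definition available :: "tm list \<Rightarrow> bool" where
  "available \<Gamma> \<longleftrightarrow> wf_ctx \<Gamma> \<and>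
     (\<forall>T. (\<forall>\<Delta>. wf_ctx \<Delta> \<longrightarrow> \<Delta> \<turnstile> T \<Colon> Type) \<longrightarrow> (\<forall>\<sigma>. subst \<sigma> T = T) \<longrightarrow>
        (\<exists>t. \<Gamma> \<turnstile> t \<Colon> T) \<longrightarrow> (\<exists>t. [] \<turnstile> t \<Colon> T))"

lemma available_Nil: "available []"
  by (auto simp: available_def intro: wf_Nil)

text \<open>A proof \<open>u\<close> over the longer context becomes the redex
  \<open>App (Lam A u) t\<close> over \<open>\<Gamma>\<close>; its type is \<open>inst T t\<close>,
  which is \<open>T\<close> by closedness. No proof term is substituted into another.\<close>

lemma available_Cons:
  assumes \<Gamma>: "available \<Gamma>" and E: "\<And>i. E i = entry \<Gamma> i"
    and A: "well_formed (\<lambda>_. False) E A \<and> well_typed (\<lambda>_. False) E t A"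
  shows "available (A # \<Gamma>)"
proof -
  have w: "wf_ctx \<Gamma>" using \<Gamma> by (simp add: available_def)
  have tyA: "\<Gamma> \<turnstile> A \<Colon> Type" using A w E entry_Some by (auto intro: well_formed_typing)
  have t: "\<Gamma> \<turnstile> t \<Colon> A" using A w tyA E entry_Some by (auto intro: well_typed_typing)
  have wA: "wf_ctx (A # \<Gamma>)" using w tyA by (rule wf_Cons)
  have "\<exists>u. [] \<turnstile> u \<Colon> T"
    if T: "\<forall>\<Delta>. wf_ctx \<Delta> \<longrightarrow> \<Delta> \<turnstile> T \<Colon> Type" "\<forall>\<sigma>. subst \<sigma> T = T" and u: "A # \<Gamma> \<turnstile> u \<Colon> T" for T u
  proof -
    have "A # \<Gamma> \<turnstile> T \<Colon> Type" using T(1) wA by simp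
    then have "\<Gamma> \<turnstile> Lam A u \<Colon> Pi A T" using tyA u by (auto intro!: t_Lam t_Pi)
    from t_App[OF this t] have "\<Gamma> \<turnstile> App (Lam A u) t \<Colon> T" using T(2) by (simp add: inst_def)
    then show ?thesis using \<Gamma> T unfolding available_def by blast
  qed
  then show ?thesis using wA unfolding available_def by auto
qed

subsection \<open>Truth values and decidable equality of numbers\<close>

definition tZero2 :: expr where "tZero2 = tInL tStar"
definition tTrue :: "expr \<Rightarrow> expr" where "tTrue b = tEq tTwo b tOne2"

definition ty_isprop_true :: expr where
  "ty_isprop_true = tPi tTwo (\<lambda>b. tIsProp (tTrue b))"

text \<open>
  \<open>tIsRefl y\<close> is a predicate on \<open>1 = y\<close> that says \<open>q = refl\<close> when \<open>y\<close> is \<open>1\<close>; based path induction into it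
  shows that every loop at \<open>1\<close> is \<open>refl\<close>, without a general theory of sets.
\<close>

definition tIsRefl :: "expr \<Rightarrow> expr" where
  "tIsRefl y = tCase tUnit tUnit (\<lambda>y. tArr (tEq tTwo tOne2 y) tUniv)
     (\<lambda>u. tLam (tEq tTwo tOne2 (tInL u)) (\<lambda>_. tUnit))
     (\<lambda>u. tUnitRec (\<lambda>u. tArr (tEq tTwo tOne2 (tInR u)) tUniv)
        (tLam (tEq tTwo tOne2 tOne2) (\<lambda>q. tEq (tEq tTwo tOne2 tOne2) q (tRfl tOne2))) u) y"
definition tLoop :: "expr \<Rightarrow> expr" where
  "tLoop p = tJ (\<lambda>y q. tIsRefl y \<cdot> q) (tRfl (tRfl tOne2)) p"

text \<open>On the left summand the equation is absurd; on the right both proofs equal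
  \<open>refl\<close> by \<open>tLoop\<close>. As conversion has no eta rule for
  \<open>Unit\<close>, \<open>UnitRec\<close> is needed to pass from \<open>InR u\<close> to
  \<open>InR Star\<close>.\<close>

definition tm_isprop_true :: expr where
  "tm_isprop_true = tLam tTwo (\<lambda>b. tCase tUnit tUnit (\<lambda>b. tIsProp (tTrue b))
     (\<lambda>u. tLam (tTrue (tInL u)) (\<lambda>p. tLam (tTrue (tInL u)) (\<lambda>q.
        tAbort (tEq (tTrue (tInL u)) p q) (tClash tUnit tUnit p))))
     (\<lambda>u. tUnitRec (\<lambda>u. tIsProp (tTrue (tInR u)))
        (tLam (tTrue tOne2) (\<lambda>p. tLam (tTrue tOne2) (\<lambda>q.
           tTransport (\<lambda>r. tEq (tTrue tOne2) p r) (tLoop p) (tSym (tTrue tOne2) q (tLoop q))))) u)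
     b)"

abbreviation ctx_isprop_true :: "tm list" where "ctx_isprop_true \<equiv> [ty_isprop_true 0]"
abbreviation isprop_true :: expr where "isprop_true \<equiv> hyp 0"
definition env_isprop_true :: "nat \<Rightarrow> tm option" where "env_isprop_true i = entry [] i"

text \<open>\<open>code_simp\<close> runs the checker. A proof term is read at the depth given by
  the length of the context over which it is checked, here 0, so that each \<open>hyp\<close> points
  to its entry; the types are closed and can be read at depth 0.\<close>

lemma available_isprop_true: "available ctx_isprop_true"
  by (rule available_Cons[OF available_Nil env_isprop_true_def, where t = "tm_isprop_true 0"]) code_simp

text \<open>The outer recursion produces a function and the inner one serves as a case distinction,
  so that equality of two successors reduces to equality of the predecessors by computation
  alone.\<close>

definition tEqb :: "expr \<Rightarrow> expr \<Rightarrow> expr" where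
  "tEqb m n = tNatRec (\<lambda>_. tArr tNat tTwo)
     (tLam tNat (\<lambda>n. tNatRec (\<lambda>_. tTwo) tOne2 (\<lambda>_ _. tZero2) n))
     (\<lambda>_ r. tLam tNat (\<lambda>n. tNatRec (\<lambda>_. tTwo) tZero2 (\<lambda>n _. r \<cdot> n) n)) m \<cdot> n"

definition ty_eqb_refl :: expr where
  "ty_eqb_refl = tPi tNat (\<lambda>n. tTrue (tEqb n n))"
definition tm_eqb_refl :: expr where
  "tm_eqb_refl = tLam tNat (\<lambda>n. tNatRec (\<lambda>n. tTrue (tEqb n n)) (tRfl tOne2) (\<lambda>_ r. r) n)"

abbreviation ctx_eqb_refl :: "tm list" where "ctx_eqb_refl \<equiv> ty_eqb_refl 0 # ctx_isprop_true"
abbreviation eqb_refl :: expr where "eqb_refl \<equiv> hyp 1"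
definition env_eqb_refl :: "nat \<Rightarrow> tm option" where "env_eqb_refl i = entry ctx_isprop_true i"

lemma available_eqb_refl: "available ctx_eqb_refl"
  by (rule available_Cons[OF available_isprop_true env_eqb_refl_def, where t = "tm_eqb_refl 1"]) code_simp

definition ty_eqb_eq :: expr where
  "ty_eqb_eq = tPi tNat (\<lambda>m. tPi tNat (\<lambda>n. tArr (tTrue (tEqb m n)) (tEq tNat m n)))"
text \<open>Double induction. In the mixed cases the hypothesis computes to a clash of the two truth
  values; for two successors it is, up to conversion, the hypothesis for the predecessors.\<close>

definition tm_eqb_eq :: expr where
  "tm_eqb_eq = tLam tNat (\<lambda>m.
     tNatRec (\<lambda>m. tPi tNat (\<lambda>n. tArr (tTrue (tEqb m n)) (tEq tNat m n)))
       (tLam tNat (\<lambda>n. tNatRec (\<lambda>n. tArr (tTrue (tEqb tZe n)) (tEq tNat tZe n))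
          (tLam (tTrue (tEqb tZe tZe)) (\<lambda>_. tRfl tZe))
          (\<lambda>n _. tLam (tTrue (tEqb tZe (tSu n))) (\<lambda>e. tAbort (tEq tNat tZe (tSu n)) (tClash tUnit tUnit e)))
          n))
       (\<lambda>m ih. tLam tNat (\<lambda>n. tNatRec (\<lambda>n. tArr (tTrue (tEqb (tSu m) n)) (tEq tNat (tSu m) n))
          (tLam (tTrue (tEqb (tSu m) tZe)) (\<lambda>e. tAbort (tEq tNat (tSu m) tZe) (tClash tUnit tUnit e)))
          (\<lambda>n _. tLam (tTrue (tEqb (tSu m) (tSu n))) (\<lambda>e.
             tTransport (\<lambda>k. tEq tNat (tSu m) (tSu k)) (tRfl (tSu m)) (ih \<cdot> n \<cdot> e)))
          n))
       m)"

abbreviation ctx_eqb_eq :: "tm list" where "ctx_eqb_eq \<equiv> ty_eqb_eq 0 # ctx_eqb_refl"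
abbreviation eqb_eq :: expr where "eqb_eq \<equiv> hyp 2"
definition env_eqb_eq :: "nat \<Rightarrow> tm option" where "env_eqb_eq i = entry ctx_eqb_refl i"

lemma available_eqb_eq: "available ctx_eqb_eq"
  by (rule available_Cons[OF available_eqb_refl env_eqb_eq_def, where t = "tm_eqb_eq 2"]) code_simp

section \<open>Binary sequences with at most one 1\<close>

definition tUnique :: "expr \<Rightarrow> expr" where
  "tUnique B = tPi tNat (\<lambda>j. tPi tNat (\<lambda>k. tArr (tTrue (B \<cdot> j)) (tArr (tTrue (B \<cdot> k)) (tEq tNat j k))))"
definition tOnes :: "expr \<Rightarrow> expr" where
  "tOnes B = tSig tNat (\<lambda>n. tTrue (B \<cdot> n))"

definition ty_isprop_ones :: expr where
  "ty_isprop_ones = tPi (tArr tNat tTwo) (\<lambda>B. tArr (tUnique B) (tIsProp (tOnes B)))"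
text \<open>Path induction along \<open>n = n'\<close> has to generalize the second component, whose
  type depends on \<open>n'\<close>. What remains are two proofs of the same truth value, equal by
  \<open>isprop_true\<close>.\<close>

definition tm_isprop_ones :: expr where
  "tm_isprop_ones = tLam (tArr tNat tTwo) (\<lambda>B. tLam (tUnique B) (\<lambda>h.
     tLam (tOnes B) (\<lambda>s. tLam (tOnes B) (\<lambda>t.
       tSplit tNat (\<lambda>n. tTrue (B \<cdot> n)) (\<lambda>s. tEq (tOnes B) s t) (\<lambda>n e.
         tSplit tNat (\<lambda>n. tTrue (B \<cdot> n)) (\<lambda>t. tEq (tOnes B) (tPr n e) t) (\<lambda>n' e'.
           tJ (\<lambda>k _. tPi (tTrue (B \<cdot> k)) (\<lambda>e'. tEq (tOnes B) (tPr n e) (tPr k e')))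
              (tLam (tTrue (B \<cdot> n)) (\<lambda>e'.
                 tTransport (\<lambda>f. tEq (tOnes B) (tPr n e) (tPr n f)) (tRfl (tPr n e))
                   (isprop_true \<cdot> (B \<cdot> n) \<cdot> e \<cdot> e')))
              (h \<cdot> n \<cdot> n' \<cdot> e \<cdot> e') \<cdot> e')
         t)
       s))))"

abbreviation ctx_isprop_ones :: "tm list" where "ctx_isprop_ones \<equiv> ty_isprop_ones 0 # ctx_eqb_eq"
abbreviation isprop_ones :: expr where "isprop_ones \<equiv> hyp 3"
definition env_isprop_ones :: "nat \<Rightarrow> tm option" where "env_isprop_ones i = entry ctx_eqb_eq i"

lemma available_isprop_ones: "available ctx_isprop_ones"
  by (rule available_Cons[OF available_eqb_eq env_isprop_ones_def, where t = "tm_isprop_ones 3"]) code_simp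

definition ty_rosoliniI :: expr where
  "ty_rosoliniI = tPi tUniv (\<lambda>P. tArr (tIsProp P) (tPi (tArr tNat tTwo) (\<lambda>B. tArr (tUnique B)
     (tArr (tArr P (tOnes B)) (tArr (tArr (tOnes B) P) (tIsRosolini P))))))"
text \<open>Proposition extensionality turns the two implications into the required equation. The
  sequence is given explicitly, so \<open>tTrIn\<close> applies directly.\<close>

definition tm_rosoliniI :: expr where
  "tm_rosoliniI = tLam tUniv (\<lambda>P. tLam (tIsProp P) (\<lambda>hP. tLam (tArr tNat tTwo) (\<lambda>B. tLam (tUnique B) (\<lambda>h.
     tLam (tArr P (tOnes B)) (\<lambda>f. tLam (tArr (tOnes B) P) (\<lambda>g.
       tTrIn (tPr B (tPr h (tPropExt hP (isprop_ones \<cdot> B \<cdot> h) f g)))))))))"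

abbreviation ctx_rosoliniI :: "tm list" where "ctx_rosoliniI \<equiv> ty_rosoliniI 0 # ctx_isprop_ones"
abbreviation rosoliniI :: expr where "rosoliniI \<equiv> hyp 4"
definition env_rosoliniI :: "nat \<Rightarrow> tm option" where "env_rosoliniI i = entry ctx_isprop_ones i"

lemma available_rosoliniI: "available ctx_rosoliniI"
  by (rule available_Cons[OF available_isprop_ones env_rosoliniI_def, where t = "tm_rosoliniI 4"]) code_simp

subsection \<open>Sequences that stay halted\<close>

text \<open>This is the \<alpha> of the introduction as a function of two consecutive
  states.\<close>

definition tFire :: "expr \<Rightarrow> expr \<Rightarrow> expr \<Rightarrow> expr" where
  "tFire p u v = tCase tNat tNat (\<lambda>_. tTwo)
     (\<lambda>_. tCase tNat tNat (\<lambda>_. tTwo) (\<lambda>_. tZero2) (\<lambda>z. p \<cdot> z) v) (\<lambda>_. tZero2) u"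
definition tHalts :: "expr \<Rightarrow> expr \<Rightarrow> expr" where
  "tHalts u y = tEq tNN u (tInR y)"
definition tStart :: "expr \<Rightarrow> expr" where
  "tStart w = tPi tNat (\<lambda>y. tArr (tHalts (w \<cdot> tZe) y) tEmpty)"
definition tStay :: "expr \<Rightarrow> expr" where
  "tStay w = tPi tNat (\<lambda>k. tPi tNat (\<lambda>y. tArr (tHalts (w \<cdot> k) y) (tHalts (w \<cdot> tSu k) y)))"
definition tSeq :: expr where "tSeq = tArr tNat tNN"
definition tPred :: expr where "tPred = tArr tNat tTwo"

definition tShift :: "expr \<Rightarrow> expr" where
  "tShift w = tLam tNat (\<lambda>n. w \<cdot> tSu n)"
definition tShiftStay :: "expr \<Rightarrow> expr" where
  "tShiftStay h = tLam tNat (\<lambda>k. h \<cdot> tSu k)"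

definition ty_stay_iter :: expr where
  "ty_stay_iter = tPi tSeq (\<lambda>w. tArr (tStay w) (tPi tNat (\<lambda>y. tArr (tHalts (w \<cdot> tZe) y)
     (tPi tNat (\<lambda>k. tHalts (w \<cdot> k) y)))))"
definition tm_stay_iter :: expr where
  "tm_stay_iter = tLam tSeq (\<lambda>w. tLam (tStay w) (\<lambda>h. tLam tNat (\<lambda>y. tLam (tHalts (w \<cdot> tZe) y) (\<lambda>e.
     tLam tNat (\<lambda>k. tNatRec (\<lambda>k. tHalts (w \<cdot> k) y) e (\<lambda>k r. h \<cdot> k \<cdot> y \<cdot> r) k)))))"

abbreviation ctx_stay_iter :: "tm list" where "ctx_stay_iter \<equiv> ty_stay_iter 0 # ctx_rosoliniI"
abbreviation stay_iter :: expr where "stay_iter \<equiv> hyp 5"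
definition env_stay_iter :: "nat \<Rightarrow> tm option" where "env_stay_iter i = entry ctx_rosoliniI i"

lemma available_stay_iter: "available ctx_stay_iter"
  by (rule available_Cons[OF available_rosoliniI env_stay_iter_def, where t = "tm_stay_iter 5"]) code_simp

definition tOutput :: "expr \<Rightarrow> expr \<Rightarrow> expr" where
  "tOutput p v = tSig tNat (\<lambda>z. tProd (tHalts v z) (tTrue (p \<cdot> z)))"
definition ty_fire_output :: expr where
  "ty_fire_output = tPi tPred (\<lambda>p. tPi tNN (\<lambda>u. tPi tNN (\<lambda>v.
     tArr (tTrue (tFire p u v)) (tOutput p v))))"
definition tm_fire_output :: expr where
  "tm_fire_output = tLam tPred (\<lambda>p. tLam tNN (\<lambda>u. tLam tNN (\<lambda>v.
     tCase tNat tNat (\<lambda>u. tArr (tTrue (tFire p u v)) (tOutput p v))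
       (\<lambda>a. tCase tNat tNat (\<lambda>v. tArr (tTrue (tFire p (tInL a) v)) (tOutput p v))
          (\<lambda>b. tLam (tTrue (tFire p (tInL a) (tInL b))) (\<lambda>e.
             tAbort (tOutput p (tInL b)) (tClash tUnit tUnit e)))
          (\<lambda>z. tLam (tTrue (tFire p (tInL a) (tInR z))) (\<lambda>e. tPr z (tPr (tRfl (tInR z)) e)))
          v)
       (\<lambda>b. tLam (tTrue (tFire p (tInR b) v)) (\<lambda>e. tAbort (tOutput p v) (tClash tUnit tUnit e)))
       u)))"

abbreviation ctx_fire_output :: "tm list" where "ctx_fire_output \<equiv> ty_fire_output 0 # ctx_stay_iter"
abbreviation fire_output :: expr where "fire_output \<equiv> hyp 6"
definition env_fire_output :: "nat \<Rightarrow> tm option" where "env_fire_output i = entry ctx_stay_iter i"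

lemma available_fire_output: "available ctx_fire_output"
  by (rule available_Cons[OF available_stay_iter env_fire_output_def, where t = "tm_fire_output 6"]) code_simp

definition ty_fire_running :: expr where
  "ty_fire_running = tPi tPred (\<lambda>p. tPi tNN (\<lambda>u. tPi tNN (\<lambda>v. tPi tNat (\<lambda>y.
     tArr (tTrue (tFire p u v)) (tArr (tHalts u y) tEmpty)))))"
definition tm_fire_running :: expr where
  "tm_fire_running = tLam tPred (\<lambda>p. tLam tNN (\<lambda>u. tLam tNN (\<lambda>v. tLam tNat (\<lambda>y.
     tCase tNat tNat (\<lambda>u. tArr (tTrue (tFire p u v)) (tArr (tHalts u y) tEmpty))
       (\<lambda>a. tLam (tTrue (tFire p (tInL a) v)) (\<lambda>_. tLam (tHalts (tInL a) y) (\<lambda>e. tClash tNat tNat e)))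
       (\<lambda>b. tLam (tTrue (tFire p (tInR b) v)) (\<lambda>e. tLam (tHalts (tInR b) y) (\<lambda>_. tClash tUnit tUnit e)))
       u))))"

abbreviation ctx_fire_running :: "tm list" where "ctx_fire_running \<equiv> ty_fire_running 0 # ctx_fire_output"
abbreviation fire_running :: expr where "fire_running \<equiv> hyp 7"
definition env_fire_running :: "nat \<Rightarrow> tm option" where "env_fire_running i = entry ctx_fire_output i"

lemma available_fire_running: "available ctx_fire_running"
  by (rule available_Cons[OF available_fire_output env_fire_running_def, where t = "tm_fire_running 7"]) code_simp

definition tFireAt :: "expr \<Rightarrow> expr \<Rightarrow> expr \<Rightarrow> expr" where
  "tFireAt p w n = tFire p (w \<cdot> n) (w \<cdot> tSu n)"
definition ty_fire_first :: expr where
  "ty_fire_first = tPi tPred (\<lambda>p. tPi tSeq (\<lambda>w. tArr (tStay w) (tPi tNat (\<lambda>k.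
     tArr (tTrue (tFireAt p w tZe)) (tArr (tTrue (tFireAt p w (tSu k))) tEmpty)))))"
text \<open>A transition at 0 leaves \<open>w 1 = inr z\<close>, and the shifted sequence stays
  there. So \<open>w (k + 1)\<close> has halted, whereas a transition at \<open>k + 1\<close> needs
  it to be running.\<close>

definition tm_fire_first :: expr where
  "tm_fire_first = tLam tPred (\<lambda>p. tLam tSeq (\<lambda>w. tLam (tStay w) (\<lambda>h. tLam tNat (\<lambda>k.
     tLam (tTrue (tFireAt p w tZe)) (\<lambda>e. tLam (tTrue (tFireAt p w (tSu k))) (\<lambda>f.
       tSplit tNat (\<lambda>z. tProd (tHalts (w \<cdot> tSu tZe) z) (tTrue (p \<cdot> z))) (\<lambda>_. tEmpty)
         (\<lambda>z q. fire_running \<cdot> p \<cdot> (w \<cdot> tSu k) \<cdot> (w \<cdot> tSu (tSu k)) \<cdot> z \<cdot> f \<cdot>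
           (stay_iter \<cdot> tShift w \<cdot> tShiftStay h \<cdot> z \<cdot> tFst (tHalts (w \<cdot> tSu tZe) z) (\<lambda>_. tTrue (p \<cdot> z)) q \<cdot> k))
         (fire_output \<cdot> p \<cdot> (w \<cdot> tZe) \<cdot> (w \<cdot> tSu tZe) \<cdot> e)))))))"

abbreviation ctx_fire_first :: "tm list" where "ctx_fire_first \<equiv> ty_fire_first 0 # ctx_fire_running"
abbreviation fire_first :: expr where "fire_first \<equiv> hyp 8"
definition env_fire_first :: "nat \<Rightarrow> tm option" where "env_fire_first i = entry ctx_fire_running i"

lemma available_fire_first: "available ctx_fire_first"
  by (rule available_Cons[OF available_fire_running env_fire_first_def, where t = "tm_fire_first 8"]) code_simp

text \<open>Induction on \<open>j\<close> for all sequences at once: shifting the sequence lowers both indices.\<close>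

definition ty_fire_unique :: expr where
  "ty_fire_unique = tPi tPred (\<lambda>p. tPi tNat (\<lambda>j. tPi tSeq (\<lambda>w. tArr (tStay w) (tPi tNat (\<lambda>k.
     tArr (tTrue (tFireAt p w j)) (tArr (tTrue (tFireAt p w k)) (tEq tNat j k)))))))"
definition tm_fire_unique :: expr where
  "tm_fire_unique = tLam tPred (\<lambda>p. tLam tNat (\<lambda>j.
     tNatRec (\<lambda>j. tPi tSeq (\<lambda>w. tArr (tStay w) (tPi tNat (\<lambda>k.
         tArr (tTrue (tFireAt p w j)) (tArr (tTrue (tFireAt p w k)) (tEq tNat j k))))))
       (tLam tSeq (\<lambda>w. tLam (tStay w) (\<lambda>h. tLam tNat (\<lambda>k.
          tNatRec (\<lambda>k. tArr (tTrue (tFireAt p w tZe)) (tArr (tTrue (tFireAt p w k)) (tEq tNat tZe k)))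
            (tLam (tTrue (tFireAt p w tZe)) (\<lambda>_. tLam (tTrue (tFireAt p w tZe)) (\<lambda>_. tRfl tZe)))
            (\<lambda>k _. tLam (tTrue (tFireAt p w tZe)) (\<lambda>e. tLam (tTrue (tFireAt p w (tSu k))) (\<lambda>f.
               tAbort (tEq tNat tZe (tSu k)) (fire_first \<cdot> p \<cdot> w \<cdot> h \<cdot> k \<cdot> e \<cdot> f))))
            k))))
       (\<lambda>j ih. tLam tSeq (\<lambda>w. tLam (tStay w) (\<lambda>h. tLam tNat (\<lambda>k.
          tNatRec (\<lambda>k. tArr (tTrue (tFireAt p w (tSu j)))
              (tArr (tTrue (tFireAt p w k)) (tEq tNat (tSu j) k)))
            (tLam (tTrue (tFireAt p w (tSu j))) (\<lambda>e. tLam (tTrue (tFireAt p w tZe)) (\<lambda>f.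
               tAbort (tEq tNat (tSu j) tZe) (fire_first \<cdot> p \<cdot> w \<cdot> h \<cdot> j \<cdot> f \<cdot> e))))
            (\<lambda>k _. tLam (tTrue (tFireAt p w (tSu j))) (\<lambda>e. tLam (tTrue (tFireAt p w (tSu k))) (\<lambda>f.
               tTransport (\<lambda>i. tEq tNat (tSu j) (tSu i)) (tRfl (tSu j))
                 (ih \<cdot> tShift w \<cdot> tShiftStay h \<cdot> k \<cdot> e \<cdot> f))))
            k))))
       j))"

abbreviation ctx_fire_unique :: "tm list" where "ctx_fire_unique \<equiv> ty_fire_unique 0 # ctx_fire_first"
abbreviation fire_unique :: expr where "fire_unique \<equiv> hyp 9"
definition env_fire_unique :: "nat \<Rightarrow> tm option" where "env_fire_unique i = entry ctx_fire_first i"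

lemma available_fire_unique: "available ctx_fire_unique"
  by (rule available_Cons[OF available_fire_first env_fire_unique_def, where t = "tm_fire_unique 9"]) code_simp

text \<open>A left inverse of \<open>inr\<close>, with default 0 on the left summand; it serves to
  extract \<open>b = z\<close> from \<open>inr b = inr z\<close>.\<close>

definition tFromInR :: "expr \<Rightarrow> expr" where
  "tFromInR v = tCase tNat tNat (\<lambda>_. tNat) (\<lambda>_. tZe) (\<lambda>b. b) v"
definition tFiring :: "expr \<Rightarrow> expr \<Rightarrow> expr" where
  "tFiring p w = tLam tNat (\<lambda>n. tFireAt p w n)"
definition ty_fire_exists :: expr where
  "ty_fire_exists = tPi tPred (\<lambda>p. tPi tSeq (\<lambda>w. tArr (tStart w) (tArr (tStay w) (tPi tNat (\<lambda>z.
     tArr (tTrue (p \<cdot> z)) (tPi tNat (\<lambda>k. tArr (tHalts (w \<cdot> k) z) (tOnes (tFiring p w)))))))))"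
text \<open>Induction on \<open>k\<close>. In the step \<open>w k\<close> is inspected with the
  equation \<open>u = w k\<close> kept in the motive: on \<open>inl a\<close> the transition is at
  \<open>k\<close>; on \<open>inr b\<close> halting persists, so \<open>b = z\<close> and the
  induction hypothesis applies.\<close>

definition tm_fire_exists :: expr where
  "tm_fire_exists = tLam tPred (\<lambda>p. tLam tSeq (\<lambda>w. tLam (tStart w) (\<lambda>h0. tLam (tStay w) (\<lambda>h.
     tLam tNat (\<lambda>z. tLam (tTrue (p \<cdot> z)) (\<lambda>pz. tLam tNat (\<lambda>k.
       tNatRec (\<lambda>k. tArr (tHalts (w \<cdot> k) z) (tOnes (tFiring p w)))
         (tLam (tHalts (w \<cdot> tZe) z) (\<lambda>e. tAbort (tOnes (tFiring p w)) (h0 \<cdot> z \<cdot> e)))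
         (\<lambda>k ih. tLam (tHalts (w \<cdot> tSu k) z) (\<lambda>e.
            tCase tNat tNat (\<lambda>u. tArr (tEq tNN u (w \<cdot> k)) (tOnes (tFiring p w)))
              (\<lambda>a. tLam (tEq tNN (tInL a) (w \<cdot> k)) (\<lambda>q. tPr k
                 (tTransport (\<lambda>u. tTrue (tFire p u (w \<cdot> tSu k)))
                   (tTransport (\<lambda>v. tTrue (tFire p (tInL a) v)) pz (tSym tNN (w \<cdot> tSu k) e)) q)))
              (\<lambda>b. tLam (tEq tNN (tInR b) (w \<cdot> k)) (\<lambda>q. ih \<cdot>
                 tTransport (\<lambda>v. tHalts (w \<cdot> k) (tFromInR v)) (tSym tNN (tInR b) q)
                   (tTransport (\<lambda>v. tHalts v z) e (h \<cdot> k \<cdot> b \<cdot> tSym tNN (tInR b) q))))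
              (w \<cdot> k) \<cdot> tRfl (w \<cdot> k)))
         k)))))))"

abbreviation ctx_fire_exists :: "tm list" where "ctx_fire_exists \<equiv> ty_fire_exists 0 # ctx_fire_unique"
abbreviation fire_exists :: expr where "fire_exists \<equiv> hyp 10"
definition env_fire_exists :: "nat \<Rightarrow> tm option" where "env_fire_exists i = entry ctx_fire_unique i"

lemma available_fire_exists: "available ctx_fire_exists"
  by (rule available_Cons[OF available_fire_unique env_fire_exists_def, where t = "tm_fire_exists 10"]) code_simp

definition ty_output_unique :: expr where
  "ty_output_unique = tPi tNat (\<lambda>y. tPi tNat (\<lambda>y'. tPi tNat (\<lambda>j. tPi tSeq (\<lambda>w. tArr (tStay w) (tPi tNat (\<lambda>k.
     tArr (tHalts (w \<cdot> j) y) (tArr (tHalts (w \<cdot> k) y') (tHalts (tInR y) y'))))))))"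
text \<open>If one index is 0, \<open>stay_iter\<close> carries its output to the other index;
  otherwise shifting lowers both, which is why the induction ranges over all sequences.\<close>

definition tm_output_unique :: expr where
  "tm_output_unique = tLam tNat (\<lambda>y. tLam tNat (\<lambda>y'. tLam tNat (\<lambda>j.
     tNatRec (\<lambda>j. tPi tSeq (\<lambda>w. tArr (tStay w) (tPi tNat (\<lambda>k.
         tArr (tHalts (w \<cdot> j) y) (tArr (tHalts (w \<cdot> k) y') (tHalts (tInR y) y'))))))
       (tLam tSeq (\<lambda>w. tLam (tStay w) (\<lambda>h. tLam tNat (\<lambda>k.
          tLam (tHalts (w \<cdot> tZe) y) (\<lambda>e. tLam (tHalts (w \<cdot> k) y') (\<lambda>f.
            tTransport (\<lambda>v. tHalts v y') f (stay_iter \<cdot> w \<cdot> h \<cdot> y \<cdot> e \<cdot> k)))))))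
       (\<lambda>j ih. tLam tSeq (\<lambda>w. tLam (tStay w) (\<lambda>h. tLam tNat (\<lambda>k.
          tNatRec (\<lambda>k. tArr (tHalts (w \<cdot> tSu j) y) (tArr (tHalts (w \<cdot> k) y') (tHalts (tInR y) y')))
            (tLam (tHalts (w \<cdot> tSu j) y) (\<lambda>e. tLam (tHalts (w \<cdot> tZe) y') (\<lambda>f.
               tTransport (\<lambda>v. tHalts v y') (stay_iter \<cdot> w \<cdot> h \<cdot> y' \<cdot> f \<cdot> tSu j) e)))
            (\<lambda>k _. tLam (tHalts (w \<cdot> tSu j) y) (\<lambda>e. tLam (tHalts (w \<cdot> tSu k) y') (\<lambda>f.
               ih \<cdot> tShift w \<cdot> tShiftStay h \<cdot> k \<cdot> e \<cdot> f)))
            k))))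
       j)))"

abbreviation ctx_output_unique :: "tm list" where "ctx_output_unique \<equiv> ty_output_unique 0 # ctx_fire_exists"
abbreviation output_unique :: expr where "output_unique \<equiv> hyp 11"
definition env_output_unique :: "nat \<Rightarrow> tm option" where "env_output_unique i = entry ctx_fire_exists i"

lemma available_output_unique: "available ctx_output_unique"
  by (rule available_Cons[OF available_fire_exists env_output_unique_def, where t = "tm_output_unique 11"]) code_simp

subsection \<open>Rosolini propositions\<close>

definition tReach :: "expr \<Rightarrow> expr \<Rightarrow> expr" where
  "tReach w y = tSig tNat (\<lambda>k. tHalts (w \<cdot> k) y)"
definition tUniqueFiring :: "expr \<Rightarrow> expr \<Rightarrow> expr \<Rightarrow> expr" where
  "tUniqueFiring p w h = tLam tNat (\<lambda>j. tLam tNat (\<lambda>k. fire_unique \<cdot> p \<cdot> j \<cdot> w \<cdot> h \<cdot> k))"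
definition tEqTo :: "expr \<Rightarrow> expr" where
  "tEqTo y = tLam tNat (\<lambda>z. tEqb z y)"

text \<open>The truncated halting time may be eliminated because its target, the type of
  transitions, is a proposition by their uniqueness. This is what stands in for choice.\<close>

definition tReachFires :: "expr \<Rightarrow> expr \<Rightarrow> expr \<Rightarrow> expr \<Rightarrow> expr \<Rightarrow> expr \<Rightarrow> expr \<Rightarrow> expr" where
  "tReachFires p w h0 h y py t =
     tTrRec (isprop_ones \<cdot> tFiring p w \<cdot> tUniqueFiring p w h) (tReach w y)
       (\<lambda>s. tSplit tNat (\<lambda>k. tHalts (w \<cdot> k) y) (\<lambda>_. tOnes (tFiring p w))
          (\<lambda>k e. fire_exists \<cdot> p \<cdot> w \<cdot> h0 \<cdot> h \<cdot> y \<cdot> py \<cdot> k \<cdot> e) s) t"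

definition ty_value_rosolini :: expr where
  "ty_value_rosolini = tPi tSeq (\<lambda>w. tArr (tStart w) (tArr (tStay w) (tPi tNat (\<lambda>y.
     tIsRosolini (tTrunc (tReach w y))))))"
text \<open>A transition at \<open>n\<close> gives halting time \<open>n + 1\<close> with some
  output \<open>z\<close>; the test at \<open>z\<close> is the equality with \<open>y\<close>, so
  \<open>eqb_eq\<close> moves the output to \<open>y\<close>. Conversely \<open>tReachFires\<close>
  applies, the test at \<open>y\<close> being \<open>eqb_refl\<close>.\<close>

definition tm_value_rosolini :: expr where
  "tm_value_rosolini = tLam tSeq (\<lambda>w. tLam (tStart w) (\<lambda>h0. tLam (tStay w) (\<lambda>h. tLam tNat (\<lambda>y.
     rosoliniI \<cdot> tTrunc (tReach w y) \<cdot>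
       tLam (tTrunc (tReach w y)) (\<lambda>a. tLam (tTrunc (tReach w y)) (\<lambda>b. tSquash a b)) \<cdot>
       tFiring (tEqTo y) w \<cdot> tUniqueFiring (tEqTo y) w h \<cdot>
       tLam (tTrunc (tReach w y)) (\<lambda>t. tReachFires (tEqTo y) w h0 h y (eqb_refl \<cdot> y) t) \<cdot>
       tLam (tOnes (tFiring (tEqTo y) w)) (\<lambda>s.
         tSplit tNat (\<lambda>n. tTrue (tFiring (tEqTo y) w \<cdot> n)) (\<lambda>_. tTrunc (tReach w y)) (\<lambda>n e.
           tSplit tNat (\<lambda>z. tProd (tHalts (w \<cdot> tSu n) z) (tTrue (tEqTo y \<cdot> z))) (\<lambda>_. tTrunc (tReach w y))
             (\<lambda>z q. tSplit (tHalts (w \<cdot> tSu n) z) (\<lambda>_. tTrue (tEqTo y \<cdot> z)) (\<lambda>_. tTrunc (tReach w y))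
               (\<lambda>f g. tTrIn (tPr (tSu n) (tTransport (\<lambda>y. tHalts (w \<cdot> tSu n) y) f (eqb_eq \<cdot> z \<cdot> y \<cdot> g)))) q)
             (fire_output \<cdot> tEqTo y \<cdot> (w \<cdot> n) \<cdot> (w \<cdot> tSu n) \<cdot> e)) s)))))"

abbreviation ctx_value_rosolini :: "tm list" where "ctx_value_rosolini \<equiv> ty_value_rosolini 0 # ctx_output_unique"
abbreviation value_rosolini :: expr where "value_rosolini \<equiv> hyp 12"
definition env_value_rosolini :: "nat \<Rightarrow> tm option" where "env_value_rosolini i = entry ctx_output_unique i"

lemma available_value_rosolini: "available ctx_value_rosolini"
  by (rule available_Cons[OF available_output_unique env_value_rosolini_def, where t = "tm_value_rosolini 12"]) code_simp

section \<open>Existence of some output\<close>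

definition tSomeValue :: "expr \<Rightarrow> expr" where
  "tSomeValue w = tSig tNat (\<lambda>y. tTrunc (tReach w y))"
text \<open>
  Two values are compared through their Boolean equality, so that the truncations can be eliminated
  into a proposition.
\<close>

definition ty_isprop_some_value :: expr where
  "ty_isprop_some_value = tPi tSeq (\<lambda>w. tArr (tStay w) (tIsProp (tSomeValue w)))"
definition tm_isprop_some_value :: expr where
  "tm_isprop_some_value = tLam tSeq (\<lambda>w. tLam (tStay w) (\<lambda>h.
     tLam (tSomeValue w) (\<lambda>s. tLam (tSomeValue w) (\<lambda>t.
       tSplit tNat (\<lambda>y. tTrunc (tReach w y)) (\<lambda>s. tEq (tSomeValue w) s t) (\<lambda>y a.
         tSplit tNat (\<lambda>y. tTrunc (tReach w y)) (\<lambda>t. tEq (tSomeValue w) (tPr y a) t) (\<lambda>y' a'.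
           tJ (\<lambda>y' _. tPi (tTrunc (tReach w y')) (\<lambda>a'. tEq (tSomeValue w) (tPr y a) (tPr y' a')))
             (tLam (tTrunc (tReach w y)) (\<lambda>a'.
                tTransport (\<lambda>b. tEq (tSomeValue w) (tPr y a) (tPr y b)) (tRfl (tPr y a)) (tSquash a a')))
             (eqb_eq \<cdot> y \<cdot> y' \<cdot>
               tTrRec (isprop_true \<cdot> tEqb y y') (tReach w y) (\<lambda>r.
                 tTrRec (isprop_true \<cdot> tEqb y y') (tReach w y') (\<lambda>r'.
                   tSplit tNat (\<lambda>j. tHalts (w \<cdot> j) y) (\<lambda>_. tTrue (tEqb y y')) (\<lambda>j e.
                     tSplit tNat (\<lambda>k. tHalts (w \<cdot> k) y') (\<lambda>_. tTrue (tEqb y y')) (\<lambda>k f.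
                       tTransport (\<lambda>v. tTrue (tEqb y (tFromInR v))) (eqb_refl \<cdot> y)
                         (output_unique \<cdot> y \<cdot> y' \<cdot> j \<cdot> w \<cdot> h \<cdot> k \<cdot> e \<cdot> f)) r') r) a') a) \<cdot> a')
         t)
       s))))"

abbreviation ctx_isprop_some_value :: "tm list" where "ctx_isprop_some_value \<equiv> ty_isprop_some_value 0 # ctx_value_rosolini"
abbreviation isprop_some_value :: expr where "isprop_some_value \<equiv> hyp 13"
definition env_isprop_some_value :: "nat \<Rightarrow> tm option" where "env_isprop_some_value i = entry ctx_value_rosolini i"

lemma available_isprop_some_value: "available ctx_isprop_some_value"
  by (rule available_Cons[OF available_value_rosolini env_isprop_some_value_def, where t = "tm_isprop_some_value 13"]) code_simp

text \<open>Not literally \<open>1\<close>, since the type of an injection cannot be inferred.\<close>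

definition tAlways :: expr where "tAlways = tLam tNat (\<lambda>z. tEqb z z)"
definition ty_domain_rosolini :: expr where
  "ty_domain_rosolini = tPi tSeq (\<lambda>w. tArr (tStart w) (tArr (tStay w) (tIsRosolini (tSomeValue w))))"
text \<open>The output lies outside the truncation and is available at once, so only the halting
  time has to be eliminated. Backwards, a transition at \<open>n\<close> supplies its output
  together with the time \<open>n + 1\<close>.\<close>

definition tm_domain_rosolini :: expr where
  "tm_domain_rosolini = tLam tSeq (\<lambda>w. tLam (tStart w) (\<lambda>h0. tLam (tStay w) (\<lambda>h.
     rosoliniI \<cdot> tSomeValue w \<cdot> (isprop_some_value \<cdot> w \<cdot> h) \<cdot> tFiring tAlways w \<cdot> tUniqueFiring tAlways w h \<cdot>
       tLam (tSomeValue w) (\<lambda>s. tSplit tNat (\<lambda>y. tTrunc (tReach w y)) (\<lambda>_. tOnes (tFiring tAlways w))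
         (\<lambda>y t. tReachFires tAlways w h0 h y (eqb_refl \<cdot> y) t) s) \<cdot>
       tLam (tOnes (tFiring tAlways w)) (\<lambda>s.
         tSplit tNat (\<lambda>n. tTrue (tFiring tAlways w \<cdot> n)) (\<lambda>_. tSomeValue w) (\<lambda>n e.
           tSplit tNat (\<lambda>z. tProd (tHalts (w \<cdot> tSu n) z) (tTrue (tAlways \<cdot> z))) (\<lambda>_. tSomeValue w)
             (\<lambda>z q. tPr z (tTrIn (tPr (tSu n)
                (tFst (tHalts (w \<cdot> tSu n) z) (\<lambda>_. tTrue (tAlways \<cdot> z)) q))))
             (fire_output \<cdot> tAlways \<cdot> (w \<cdot> n) \<cdot> (w \<cdot> tSu n) \<cdot> e)) s))))"

abbreviation ctx_domain_rosolini :: "tm list" where "ctx_domain_rosolini \<equiv> ty_domain_rosolini 0 # ctx_isprop_some_value"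
abbreviation domain_rosolini :: expr where "domain_rosolini \<equiv> hyp 14"
definition env_domain_rosolini :: "nat \<Rightarrow> tm option" where "env_domain_rosolini i = entry ctx_isprop_some_value i"

lemma available_domain_rosolini: "available ctx_domain_rosolini"
  by (rule available_Cons[OF available_isprop_some_value env_domain_rosolini_def, where t = "tm_domain_rosolini 14"]) code_simp

section \<open>Runs determined by two functions\<close>

text \<open>
  The run of a machine depends only on the two underlying functions \<open>f\<close> and \<open>g\<close>; abstracting them keeps
  the proofs of primitive recursiveness out of the terms to be checked.
\<close>

definition tStepOf :: "expr \<Rightarrow> expr \<Rightarrow> expr" where
  "tStepOf g v = tCase tNat tNat (\<lambda>_. tNN) (\<lambda>a. tDecode (g \<cdot> a)) (\<lambda>b. tInR b) v"
definition tRunOf :: "expr \<Rightarrow> expr \<Rightarrow> expr \<Rightarrow> expr \<Rightarrow> expr" where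
  "tRunOf f g x k = tNatRec (\<lambda>_. tNN) (tInL (f \<cdot> x)) (\<lambda>_ v. tStepOf g v) k"
definition tROf :: "expr \<Rightarrow> expr \<Rightarrow> expr \<Rightarrow> expr \<Rightarrow> expr" where
  "tROf f g x y = tTrunc (tSig tNat (\<lambda>k. tEq tNN (tRunOf f g x k) (tInR y)))"

definition tRuns :: "expr \<Rightarrow> expr \<Rightarrow> expr \<Rightarrow> expr" where
  "tRuns f g x = tLam tNat (\<lambda>k. tRunOf f g x k)"
definition tRunsStart :: "expr \<Rightarrow> expr \<Rightarrow> expr" where
  "tRunsStart f x = tLam tNat (\<lambda>y. tLam (tHalts (tInL (f \<cdot> x)) y) (\<lambda>e. tClash tNat tNat e))"
text \<open>By computation the state at \<open>k + 1\<close> is the step applied to the state at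
  \<open>k\<close>; once the latter is replaced by \<open>inr y\<close>, the step computes to
  \<open>inr y\<close>.\<close>

definition tRunsStay :: "expr \<Rightarrow> expr \<Rightarrow> expr \<Rightarrow> expr" where
  "tRunsStay f g x = tLam tNat (\<lambda>k. tLam tNat (\<lambda>y. tLam (tHalts (tRunOf f g x k) y) (\<lambda>e.
     tTransport (\<lambda>v. tEq tNN (tRunOf f g x (tSu k)) (tStepOf g v)) (tRfl (tRunOf f g x (tSu k))) e)))"

definition ty_run_rosolini :: expr where
  "ty_run_rosolini = tPi (tArr tNat tNat) (\<lambda>f. tPi (tArr tNat tNat) (\<lambda>g. tPi tNat (\<lambda>x. tPi tNat (\<lambda>y.
     tProd (tIsRosolini (tROf f g x y)) (tIsRosolini (tSig tNat (\<lambda>y. tROf f g x y)))))))"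
definition tm_run_rosolini :: expr where
  "tm_run_rosolini = tLam (tArr tNat tNat) (\<lambda>f. tLam (tArr tNat tNat) (\<lambda>g. tLam tNat (\<lambda>x. tLam tNat (\<lambda>y. tPr
     (value_rosolini \<cdot> tRuns f g x \<cdot> tRunsStart f x \<cdot> tRunsStay f g x \<cdot> y)
     (domain_rosolini \<cdot> tRuns f g x \<cdot> tRunsStart f x \<cdot> tRunsStay f g x)))))"

abbreviation ctx_run_rosolini :: "tm list" where "ctx_run_rosolini \<equiv> ty_run_rosolini 0 # ctx_domain_rosolini"
abbreviation run_rosolini :: expr where "run_rosolini \<equiv> hyp 15"
definition env_run_rosolini :: "nat \<Rightarrow> tm option" where "env_run_rosolini i = entry ctx_domain_rosolini i"

lemma available_run_rosolini: "available ctx_run_rosolini"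
  by (rule available_Cons[OF available_domain_rosolini env_run_rosolini_def, where t = "tm_run_rosolini 15"]) code_simp

section \<open>Instantiation to recursive machines\<close>

definition ty_main :: expr where
  "ty_main = tPi tMachine (\<lambda>m. tPi tNat (\<lambda>x. tPi tNat (\<lambda>y.
           tProd (tIsRosolini (tR m x y))
                 (tIsRosolini (tSig tNat (\<lambda>y. tR m x y))))))"
text \<open>At these two functions \<open>tROf\<close> becomes \<open>tR\<close>, so the arguments
  \<open>x\<close> and \<open>y\<close> are left to \<open>run_rosolini\<close>.\<close>

definition tm_main :: expr where
  "tm_main = tLam tMachine (\<lambda>m. run_rosolini \<cdot> tInit m \<cdot> tStep m)"

lemma tPrimRec_type: "wf_ctx \<Gamma> \<Longrightarrow> \<Gamma> \<turnstile> tPrimRec 0 \<Colon> Type"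
proof -
  have "well_formed (\<lambda>_. False) (\<lambda>_. None) (tPrimRec 0)" by code_simp
  then show "wf_ctx \<Gamma> \<Longrightarrow> \<Gamma> \<turnstile> tPrimRec 0 \<Colon> Type" by (auto intro: well_formed_typing)
qed

text \<open>The formation of \<open>tPrimRec\<close> is checked once and then accepted at sight.
  Inspecting the head first keeps comparisons with this large term rare.\<close>

definition known :: "tm \<Rightarrow> bool" where
  "known t = (case t of Sig _ _ \<Rightarrow> t = tPrimRec 0 | _ \<Rightarrow> False)"

lemma known_type: "known A \<Longrightarrow> wf_ctx \<Gamma> \<Longrightarrow> \<Gamma> \<turnstile> A \<Colon> Type"
  using tPrimRec_type by (auto simp: known_def split: tm.splits)

lemma ty_main_type: "wf_ctx \<Gamma> \<Longrightarrow> \<Gamma> \<turnstile> ty_main 0 \<Colon> Type"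
proof -
  have "well_formed known (\<lambda>_. None) (ty_main 0)" by code_simp
  then show "wf_ctx \<Gamma> \<Longrightarrow> \<Gamma> \<turnstile> ty_main 0 \<Colon> Type"
    using known_type by (auto intro: well_formed_typing)
qed

lemma ty_main_closed: "subst \<sigma> (ty_main 0) = ty_main 0"
  by code_simp

definition env_main :: "nat \<Rightarrow> tm option" where
  "env_main i = entry ctx_run_rosolini i"

lemma tm_main_typed: "ctx_run_rosolini \<turnstile> tm_main 16 \<Colon> ty_main 0"
proof -
  \<comment> \<open>The depth 16 is the number of entries of
    \<open>ctx_run_rosolini\<close>.\<close>
  have c: "well_typed known env_main (tm_main 16) (ty_main 0)" by code_simp
  have w: "wf_ctx ctx_run_rosolini" using available_run_rosolini by (simp add: available_def)
  show ?thesis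
  proof (rule well_typed_typing[OF c w ty_main_type[OF w]])
    show "\<Gamma> \<turnstile> A \<Colon> Type" if "known A" "wf_ctx \<Gamma>" for A \<Gamma> using that by (rule known_type)
    show "i < length ctx_run_rosolini \<and> ctx_run_rosolini ! i = A" if "env_main i = Some A" for i A
      by (rule entry_Some) (use that in \<open>simp only: env_main_def\<close>)
  qed
qed

theorem theorem9p1:
  shows "provable (tPi tMachine (\<lambda>m. tPi tNat (\<lambda>x. tPi tNat (\<lambda>y.
           tProd (tIsRosolini (tR m x y))
                 (tIsRosolini (tSig tNat (\<lambda>y. tR m x y)))))))"
proof -
  \<comment> \<open>The statement is closed and formed in every context, so \<open>available\<close>
    discharges all lemmas at once.\<close>
  have "\<exists>t. [] \<turnstile> t \<Colon> ty_main 0"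
    using available_run_rosolini ty_main_type ty_main_closed tm_main_typed
    unfolding available_def by blast
  then show ?thesis by (simp only: provable_def ty_main_def)
qed

end
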